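(* Consider the steady state of the entrepreneur economy described in the context, with constant tax rate $\tau\in[0,1)$. Let $$K=K(\tau):=(f')^{-1}\left(\frac{\beta}{1-\tau}\right)L$$ be the steady state aggregate capital. Then the worker welfare without redistribution $\mathcal{W}_W^0$, the worker welfare with redistribution $\mathcal{W}_W^1$, the entrepreneur welfare $\mathcal{W}_E$, and the aggregate tax revenue $\mathcal{T}$ are given by $$\mathcal{W}_W^0=f(K/L)-(K/L)f'(K/L),$$ $$\mathcal{W}_W^1=f(K/L)-\beta K/L,$$ $$\mathcal{W}_E=\beta e^{-\frac{1}{2\beta}(1-\tau)^2\gamma\sigma^2}K,$$ $$\mathcal{T}=\tau Kf'(K/L)=(f'(K/L)-\beta)K.$$ Both $\mathcal{W}_W^1$ and $\mathcal{W}_W^0$ are strictly decreasing in the tax rate $\tau$. If in addition the production function is Cobb-Douglas, $F(k,l)=Ak^\rho l^{1-\rho}-\delta k$ with $A>0$, $\rho\in(0,1)$, $\delta\ge0$, then $\mathcal{W}_E$ and $\mathcal{T}$ are both single-peaked (initially increasing and then decreasing) in $\tau$.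
   Context: Model. Time is continuous. There is mass $1$ of entrepreneurs and mass $L>0$ of workers. Workers inelastically supply one unit of labor, earn the wage $\omega_t$ and consume all their income. Entrepreneurs operate firms with capital $k_t$ and labor $l_t$, trade risk-free bonds $b_t$ in zero net supply at interest rate $r_t$, and exit at Poisson rate $\lambda>0$. Net worth $w_t=k_t+b_t$ evolves as $$dw_t=(1-\tau_t)\bigl((F(k_t,l_t)-\omega_tl_t)\,dt+\sigma k_t\,dB_t+r_tb_t\,dt\bigr)-c_t\,dt,$$ with $\tau_t\in[0,1)$ the marginal tax rate, $\sigma>0$, and $B_t$ a standard Brownian motion independent across entrepreneurs. Exiting entrepreneurs are replaced by new ones; their capital is recycled, and each new entrepreneur's initial endowment equals the average capital of exiting entrepreneurs. Production: $F$ is homogeneous of degree 1, and $f(k):=F(k,1)$ is twice continuously differentiable on $(0,\infty)$ with $f''<0$, $f'(0)=\infty$, $f'(\infty)\le0$. Preferences: an entrepreneur maximizes the recursive utility $U_t=E_t\int_t^\infty h(c_s,U_s)\,ds$, where $h(c,v)=\beta v\bigl((1-\gamma)\log c-\log[(1-\gamma)v]\bigr)$, with discount rate $\beta>0$ and relative risk aversion $\gamma>0$, $\gamma\ne1$, subject to the budget constraint and $k_t,l_t,c_t\ge0$, taking $(r_t,\omega_t)$ as given. Equilibrium: entrepreneurs optimize, and the bond and labor markets clear. All entrepreneurs hold no bonds ($b=0$) and use the same capital-labor ratio $k/l=K/L$, where $K$ is aggregate capital; profit maximization gives $\omega=f(K/L)-(K/L)f'(K/L)$. The expected return on capital is $\mu=f'(K/L)$.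 The optimal fraction of wealth invested in capital is $\theta=k/w=\max\{\mu-r,0\}/((1-\tau)\gamma\sigma^2)$, so bond market clearing is $\theta=1$. Optimal consumption is $c=\beta w$. Aggregate capital follows $dK=[(1-\tau)f'(K/L)-\beta]K\,dt$, so in the steady state ($\tau$, $K$ constant) $f'(K/L)=\beta/(1-\tau)$. Welfare criteria: in steady state the value function of an entrepreneur with wealth $w$ has the form $J(w)=\frac1{1-\gamma}(aw)^{1-\gamma}$ for a constant $a>0$, and since an entrepreneur has initial capital $K$, $\mathcal{W}_E:=aK$. $\mathcal{W}_W^0:=\omega$ is worker consumption when tax revenue is wasted; $\mathcal{W}_W^1:=\omega+\mathcal{T}/L$ is worker consumption when tax revenue is fully redistributed to workers, where $\mathcal{T}$ is the aggregate tax revenue (per unit of time) collected from entrepreneurs.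
   Formalization: W_E need not be initially increasing (β=1, δ=0, ρ=1/2, γσ²=1: strictly decreasing); proved instead: W_E is single-peaked on [0,1), with peak at τ>0 iff β²<(1−ρ)(β+δ)γσ², otherwise at τ=0. *)

theory Defs
  imports "HOL-Probability.Probability"
begin

section \<open>Primitives\<close>

record economy =
  prod_fn :: "real \<Rightarrow> real \<Rightarrow> real"
  workers :: real
  disc :: real
  rra :: real
  vol :: real
  exit_rate :: real

definition unit_prod :: "economy \<Rightarrow> real \<Rightarrow> real" where
  "unit_prod E k = prod_fn E k 1"

text \<open>
  The limit of \<open>f'\<close> at infinity exists in the extended reals because \<open>f'\<close> is decreasing; the value
  \<open>-\<infinity>\<close> is not excluded.
\<close>

definition economy :: "economy \<Rightarrow> bool" where
  "economy E \<longleftrightarrow>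
     workers E > 0 \<and> disc E > 0 \<and> rra E > 0 \<and> rra E \<noteq> 1 \<and> vol E > 0 \<and> exit_rate E > 0 \<and>
     (\<forall>t>0. \<forall>k\<ge>0. \<forall>l\<ge>0. prod_fn E (t * k) (t * l) = t * prod_fn E k l) \<and>
     (\<forall>k>0. unit_prod E differentiable (at k)) \<and>
     (\<forall>k>0. deriv (unit_prod E) differentiable (at k)) \<and>
     continuous_on {0<..} (deriv (deriv (unit_prod E))) \<and>
     (\<forall>k>0. deriv (deriv (unit_prod E)) k < 0) \<and>
     filterlim (deriv (unit_prod E)) at_top (at_right 0) \<and>
     (\<exists>m::ereal. m \<le> 0 \<and> ((\<lambda>k. ereal (deriv (unit_prod E) k)) \<longlongrightarrow> m) at_top)"

definition cobb_douglas :: "economy \<Rightarrow> real \<Rightarrow> real \<Rightarrow> real \<Rightarrow> bool" where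
  "cobb_douglas E A \<rho> \<delta> \<longleftrightarrow> A > 0 \<and> 0 < \<rho> \<and> \<rho> < 1 \<and> \<delta> \<ge> 0 \<and>
     (\<forall>k\<ge>0. \<forall>l\<ge>0. prod_fn E k l = A * k powr \<rho> * l powr (1 - \<rho>) - \<delta> * k)"

definition aggregator :: "economy \<Rightarrow> real \<Rightarrow> real \<Rightarrow> real" where
  "aggregator E c v = disc E * v * ((1 - rra E) * ln c - ln ((1 - rra E) * v))"


section \<open>Brownian motion and the Ito integral\<close>

text \<open>Time is \<open>[0, \<infinity>)\<close>; the values of processes and filtrations at negative times are irrelevant.\<close>

definition brownian_motion :: "'s measure \<Rightarrow> (real \<Rightarrow> 's measure) \<Rightarrow> (real \<Rightarrow> 's \<Rightarrow> real) \<Rightarrow> bool" where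
  "brownian_motion M \<F> B \<longleftrightarrow>
     prob_space M \<and> filtration (space M) \<F> \<and> (\<forall>t. subalgebra M (\<F> t)) \<and>
     (\<forall>t\<ge>0. B t \<in> borel_measurable (\<F> t)) \<and>
     (AE x in M. B 0 x = 0) \<and>
     (\<forall>x\<in>space M. continuous_on {0..} (\<lambda>t. B t x)) \<and>
     (\<forall>s\<ge>0. \<forall>t>s.
        distributed M lborel (\<lambda>x. B t x - B s x) (normal_density 0 (sqrt (t - s))) \<and>
        prob_space.indep_set M (sets (\<F> s))
          (sets (vimage_algebra (space M) (\<lambda>x. B t x - B s x) borel)))"

definition progressive :: "(real \<Rightarrow> 's measure) \<Rightarrow> (real \<Rightarrow> 's \<Rightarrow> real) \<Rightarrow> bool" where
  "progressive \<F> X \<longleftrightarrow>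
     (\<forall>t\<ge>0. (\<lambda>(s, x). X s x) \<in> borel_measurable (restrict_space borel {0..t} \<Otimes>\<^sub>M \<F> t))"

text \<open>
  A simple integrand on \<open>[0, T]\<close> takes the value \<open>\<xi> i\<close> on \<open>(p i, p (i + 1)]\<close> for \<open>i < n\<close> and vanishes
  elsewhere.
\<close>

definition simple_integrand ::
  "'s measure \<Rightarrow> (real \<Rightarrow> 's measure) \<Rightarrow> real \<Rightarrow> nat \<Rightarrow> (nat \<Rightarrow> real) \<Rightarrow> (nat \<Rightarrow> 's \<Rightarrow> real) \<Rightarrow> bool" where
  "simple_integrand M \<F> T n p \<xi> \<longleftrightarrow>
     (\<forall>i\<le>n. 0 \<le> p i \<and> p i \<le> T) \<and> (\<forall>i<n. p i \<le> p (Suc i)) \<and>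
     (\<forall>i<n. \<xi> i \<in> borel_measurable (\<F> (p i)) \<and> integrable M (\<lambda>x. (\<xi> i x)\<^sup>2))"

definition simple_value ::
  "nat \<Rightarrow> (nat \<Rightarrow> real) \<Rightarrow> (nat \<Rightarrow> 's \<Rightarrow> real) \<Rightarrow> real \<Rightarrow> 's \<Rightarrow> real" where
  "simple_value n p \<xi> s x = (\<Sum>i<n. \<xi> i x * indicator {p i<..p (Suc i)} s)"

definition simple_integral ::
  "(real \<Rightarrow> 's \<Rightarrow> real) \<Rightarrow> nat \<Rightarrow> (nat \<Rightarrow> real) \<Rightarrow> (nat \<Rightarrow> 's \<Rightarrow> real) \<Rightarrow> 's \<Rightarrow> real" where
  "simple_integral B n p \<xi> x = (\<Sum>i<n. \<xi> i x * (B (p (Suc i)) x - B (p i) x))"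

text \<open>
  \<open>I\<close> is (a version of) the Ito integral of \<open>X\<close> over \<open>[0, T]\<close>: the mean-square limit of the integrals
  of simple integrands that converge to \<open>X\<close> in the mean square. The first limit makes \<open>X\<close> square
  integrable on \<open>[0, T] \<times> \<Omega>\<close>.
\<close>

definition has_ito_integral ::
  "'s measure \<Rightarrow> (real \<Rightarrow> 's measure) \<Rightarrow> (real \<Rightarrow> 's \<Rightarrow> real) \<Rightarrow> (real \<Rightarrow> 's \<Rightarrow> real) \<Rightarrow> real
     \<Rightarrow> ('s \<Rightarrow> real) \<Rightarrow> bool" where
  "has_ito_integral M \<F> B X T I \<longleftrightarrow>
     progressive \<F> X \<and> I \<in> borel_measurable M \<and>
     (\<exists>n p \<xi>.
        (\<forall>m. simple_integrand M \<F> T (n m) (p m) (\<xi> m)) \<and>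
        (\<lambda>m. \<integral>\<^sup>+x. (\<integral>\<^sup>+s. ennreal ((X s x - simple_value (n m) (p m) (\<xi> m) s x)\<^sup>2) * indicator {0..T} s
               \<partial>lborel) \<partial>M) \<longlonglongrightarrow> 0 \<and>
        (\<lambda>m. \<integral>\<^sup>+x. ennreal ((simple_integral B (n m) (p m) (\<xi> m) x - I x)\<^sup>2) \<partial>M) \<longlonglongrightarrow> 0)"


section \<open>The problem of an entrepreneur\<close>

text \<open>Taxes and prices are constant, as they are in a steady state.\<close>

record 's plan =
  wealth :: "real \<Rightarrow> 's \<Rightarrow> real"
  capital :: "real \<Rightarrow> 's \<Rightarrow> real"
  labor :: "real \<Rightarrow> 's \<Rightarrow> real"
  bonds :: "real \<Rightarrow> 's \<Rightarrow> real"
  consumption :: "real \<Rightarrow> 's \<Rightarrow> real"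

text \<open>The tax base, net of the idiosyncratic risk \<open>\<sigma> k dB\<close>, which has mean zero.\<close>

definition income :: "economy \<Rightarrow> real \<Rightarrow> real \<Rightarrow> real \<Rightarrow> real \<Rightarrow> real \<Rightarrow> real" where
  "income E r \<omega> k l b = prod_fn E k l - \<omega> * l + r * b"

definition wealth_drift :: "economy \<Rightarrow> real \<Rightarrow> real \<Rightarrow> real \<Rightarrow> 's plan \<Rightarrow> real \<Rightarrow> 's \<Rightarrow> real" where
  "wealth_drift E \<tau> r \<omega> P s x =
     (1 - \<tau>) * income E r \<omega> (capital P s x) (labor P s x) (bonds P s x) - consumption P s x"

text \<open>
  Consumption and wealth are strictly positive, because \<open>ln 0 = 0\<close> would give a plan with zero
  consumption a finite utility instead of the intended minus infinity, and similarly for the value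
  function at zero wealth.
\<close>

definition admissible ::
  "economy \<Rightarrow> real \<Rightarrow> real \<Rightarrow> real \<Rightarrow> 's measure \<Rightarrow> (real \<Rightarrow> 's measure) \<Rightarrow> (real \<Rightarrow> 's \<Rightarrow> real)
     \<Rightarrow> real \<Rightarrow> 's plan \<Rightarrow> bool" where
  "admissible E \<tau> r \<omega> M \<F> B w0 P \<longleftrightarrow>
     progressive \<F> (wealth P) \<and> progressive \<F> (capital P) \<and> progressive \<F> (labor P) \<and>
     progressive \<F> (bonds P) \<and> progressive \<F> (consumption P) \<and>
     (AE x in M. continuous_on {0..} (\<lambda>t. wealth P t x)) \<and>
     (AE x in M. \<forall>t\<ge>0. wealth P t x = capital P t x + bonds P t x \<and> wealth P t x > 0 \<and>
        capital P t x \<ge> 0 \<and> labor P t x \<ge> 0 \<and> consumption P t x > 0) \<and>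
     (AE x in M. \<forall>t\<ge>0. set_integrable lborel {0..t} (\<lambda>s. wealth_drift E \<tau> r \<omega> P s x)) \<and>
     (\<forall>t\<ge>0. has_ito_integral M \<F> B (\<lambda>s x. (1 - \<tau>) * vol E * capital P s x) t
        (\<lambda>x. wealth P t x - w0 - (LBINT s:{0..t}. wealth_drift E \<tau> r \<omega> P s x)))"

definition accrued_utility ::
  "economy \<Rightarrow> (real \<Rightarrow> 's \<Rightarrow> real) \<Rightarrow> (real \<Rightarrow> 's \<Rightarrow> real) \<Rightarrow> real \<Rightarrow> real \<Rightarrow> 's \<Rightarrow> real" where
  "accrued_utility E c U t T x = (LBINT s:{t..T}. aggregator E (c s x) (U s x)) + U T x"

definition utility_integrable ::
  "economy \<Rightarrow> 's measure \<Rightarrow> (real \<Rightarrow> 's \<Rightarrow> real) \<Rightarrow> (real \<Rightarrow> 's \<Rightarrow> real) \<Rightarrow> bool" where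
  "utility_integrable E M c U \<longleftrightarrow>
     (\<forall>T\<ge>0. integrable M (U T) \<and>
        set_integrable (lborel \<Otimes>\<^sub>M M) ({0..T} \<times> space M)
          (\<lambda>(s, x). aggregator E (c s x) (U s x)))"

text \<open>
  The infinite-horizon recursion \<open>U t = E t (\<integral> t..\<infinity>. h (c s) (U s) ds)\<close> in Duffie--Epstein form: the
  recursion between any two dates. Integrating literally up to infinity is not possible for
  \<open>\<gamma> > 1\<close>, where the integral along the optimal plan diverges although \<open>U\<close> is finite.
\<close>

definition recursive_utility ::
  "economy \<Rightarrow> 's measure \<Rightarrow> (real \<Rightarrow> 's measure) \<Rightarrow> (real \<Rightarrow> 's \<Rightarrow> real) \<Rightarrow> (real \<Rightarrow> 's \<Rightarrow> real) \<Rightarrow> bool" where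
  "recursive_utility E M \<F> c U \<longleftrightarrow>
     utility_integrable E M c U \<and>
     (\<forall>t\<ge>0. \<forall>T\<ge>t. AE x in M. U t x = real_cond_exp M (\<F> t) (accrued_utility E c U t T) x)"

text \<open>
  \<open>J\<close> is the value function and the plans satisfying \<open>Opt\<close> are optimal: from every initial wealth, an
  optimal plan has the continuation utility \<open>J (w t)\<close> at every date, and no admissible plan does better
  (dynamic programming principle for recursive utility).
\<close>

definition value_function ::
  "economy \<Rightarrow> real \<Rightarrow> real \<Rightarrow> real \<Rightarrow> 's measure \<Rightarrow> (real \<Rightarrow> 's measure) \<Rightarrow> (real \<Rightarrow> 's \<Rightarrow> real)
     \<Rightarrow> ('s plan \<Rightarrow> bool) \<Rightarrow> (real \<Rightarrow> real) \<Rightarrow> bool" where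
  "value_function E \<tau> r \<omega> M \<F> B Opt J \<longleftrightarrow>
     (\<forall>w0>0.
        (\<exists>P. Opt P \<and> admissible E \<tau> r \<omega> M \<F> B w0 P \<and>
           recursive_utility E M \<F> (consumption P) (\<lambda>t x. J (wealth P t x))) \<and>
        (\<forall>P. admissible E \<tau> r \<omega> M \<F> B w0 P \<longrightarrow>
           utility_integrable E M (consumption P) (\<lambda>t x. J (wealth P t x)) \<longrightarrow>
           (\<forall>T\<ge>0. (LINT x|M. accrued_utility E (consumption P) (\<lambda>t x. J (wealth P t x)) 0 T x)
              \<le> J w0)))"


section \<open>Steady state equilibrium\<close>

text \<open>
  \<open>wealth_dist\<close> is the cross-sectional distribution of entrepreneurial wealth, \<open>cap_share\<close> the fraction
  \<open>\<theta>\<close> of wealth invested in capital, \<open>cap_lab\<close> the capital-labor ratio of firms, and \<open>val_coef\<close> the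
  constant \<open>a\<close> in the value function.
\<close>

record equilibrium =
  wealth_dist :: "real measure"
  interest :: real
  wage :: real
  cap_share :: real
  cap_lab :: real
  val_coef :: real

definition pol_capital :: "equilibrium \<Rightarrow> real \<Rightarrow> real" where
  "pol_capital e w = cap_share e * w"

definition pol_labor :: "equilibrium \<Rightarrow> real \<Rightarrow> real" where
  "pol_labor e w = pol_capital e w / cap_lab e"

definition pol_bonds :: "equilibrium \<Rightarrow> real \<Rightarrow> real" where
  "pol_bonds e w = w - pol_capital e w"

definition pol_consumption :: "economy \<Rightarrow> real \<Rightarrow> real" where
  "pol_consumption E w = disc E * w"

definition pol_income :: "economy \<Rightarrow> equilibrium \<Rightarrow> real \<Rightarrow> real" where
  "pol_income E e w = income E (interest e) (wage e) (pol_capital e w) (pol_labor e w) (pol_bonds e w)"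

definition follows_policy :: "economy \<Rightarrow> equilibrium \<Rightarrow> 's measure \<Rightarrow> 's plan \<Rightarrow> bool" where
  "follows_policy E e M P \<longleftrightarrow> (AE x in M. \<forall>t\<ge>0.
     capital P t x = pol_capital e (wealth P t x) \<and>
     labor P t x = pol_labor e (wealth P t x) \<and>
     bonds P t x = pol_bonds e (wealth P t x) \<and>
     consumption P t x = pol_consumption E (wealth P t x))"

definition agg_capital :: "equilibrium \<Rightarrow> real" where
  "agg_capital e = (LINT w|wealth_dist e. pol_capital e w)"

text \<open>Exit is independent of wealth, so the average capital of exiting entrepreneurs is \<open>agg_capital\<close>.\<close>

definition entrant_capital :: "equilibrium \<Rightarrow> real" where
  "entrant_capital e = agg_capital e"

definition tax_revenue :: "economy \<Rightarrow> real \<Rightarrow> equilibrium \<Rightarrow> real" where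
  "tax_revenue E \<tau> e = (LINT w|wealth_dist e. \<tau> * pol_income E e w)"

text \<open>
  Time derivative of aggregate capital: net saving of incumbents (their idiosyncratic risks average
  out) minus the capital of exiting entrepreneurs plus the endowments of entrants.
\<close>

definition capital_growth :: "economy \<Rightarrow> real \<Rightarrow> equilibrium \<Rightarrow> real" where
  "capital_growth E \<tau> e =
     (LINT w|wealth_dist e. (1 - \<tau>) * pol_income E e w - pol_consumption E w)
     - exit_rate E * agg_capital e + exit_rate E * entrant_capital e"

text \<open>
  The optimal linear policy and the form of the value function are the known solution of the
  entrepreneur's problem. Market clearing yields \<open>\<theta> = 1\<close> and \<open>cap_lab e = K / L\<close>.
\<close>

definition steady_state ::
  "economy \<Rightarrow> 's measure \<Rightarrow> (real \<Rightarrow> 's measure) \<Rightarrow> (real \<Rightarrow> 's \<Rightarrow> real) \<Rightarrow> real \<Rightarrow> equilibrium \<Rightarrow> bool" where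
  "steady_state E M \<F> B \<tau> e \<longleftrightarrow>
     prob_space (wealth_dist e) \<and> sets (wealth_dist e) = sets (restrict_space borel {0<..}) \<and>
     integrable (wealth_dist e) (\<lambda>w. w) \<and>
     cap_lab e > 0 \<and>
     (\<forall>k>0. \<forall>l\<ge>0. prod_fn E k l - wage e * l
        \<le> prod_fn E k (k / cap_lab e) - wage e * (k / cap_lab e)) \<and>
     cap_share e = max (deriv (unit_prod E) (cap_lab e) - interest e) 0
        / ((1 - \<tau>) * rra E * (vol E)\<^sup>2) \<and>
     val_coef e > 0 \<and>
     value_function E \<tau> (interest e) (wage e) M \<F> B (follows_policy E e M)
       (\<lambda>w. 1 / (1 - rra E) * (val_coef e * w) powr (1 - rra E)) \<and>
     (LINT w|wealth_dist e. pol_bonds e w) = 0 \<and>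
     (LINT w|wealth_dist e. pol_labor e w) = workers E \<and>
     capital_growth E \<tau> e = 0"


section \<open>Welfare\<close>

definition worker_welfare_wasted :: "equilibrium \<Rightarrow> real" where
  "worker_welfare_wasted e = wage e"

definition worker_welfare_redist :: "economy \<Rightarrow> real \<Rightarrow> equilibrium \<Rightarrow> real" where
  "worker_welfare_redist E \<tau> e = wage e + tax_revenue E \<tau> e / workers E"

definition entrepreneur_welfare :: "equilibrium \<Rightarrow> real" where
  "entrepreneur_welfare e = val_coef e * entrant_capital e"

definition single_peaked_at :: "real set \<Rightarrow> (real \<Rightarrow> real) \<Rightarrow> real \<Rightarrow> bool" where
  "single_peaked_at S g p \<longleftrightarrow>
     p \<in> S \<and> strict_mono_on (S \<inter> {..p}) g \<and> strict_antimono_on (S \<inter> {p..}) g"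

end

theory Submission
  imports Defs
begin

text \<open>
  Market clearing gives \<open>\<theta> = 1\<close>, the first-order condition of the firms gives the wage, and constancy
  of aggregate capital gives \<open>f' (K / L) = \<beta> / (1 - \<tau>)\<close>. Hence the wealth of an entrepreneur has no
  drift: \<open>dW = s W dB\<close> with \<open>s = (1 - \<tau>) \<sigma>\<close>, so that \<open>W t = W 0 * exp (s * B t - s\<^sup>2 * t / 2)\<close>.
  Inserting this into the recursion for the utility \<open>J (W t)\<close> yields the coefficient \<open>a\<close> of the value
  function. The derivatives of \<open>f k - k f' k\<close> and \<open>f k - \<beta> k\<close> are positive below the capital-labor
  ratio of the untaxed economy, which is decreasing in \<open>\<tau>\<close>. In the Cobb-Douglas case the derivatives
  of \<open>W\<^sub>E\<close> and of the tax revenue are a positive factor times a decreasing function of \<open>\<tau>\<close>.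
\<close>

subsection \<open>Square integrable functions\<close>

text \<open>The Ito integral is given only as a mean-square limit, so wealth cannot be found by
  applying Ito's formula to its logarithm. Such a limit preserves inner products, and these suffice.
  Against the weight \<open>exp (\<theta> * B T x)\<close> a Brownian increment of length
  \<open>h\<close> acts like the number \<open>\<theta> * h\<close> (the drift produced by a change
  of measure), so the pairing of a stochastic integral with this weight is a time integral. Wealth
  at a fixed date is then identified through its mean-square distance to the candidate, which needs
  only three second moments. The drift of wealth vanishes for an accounting reason: with constant
  returns, wage equal to the marginal product of labor and no bonds, income is wealth times the
  marginal product of capital, and its after-tax value \<open>\<beta> * w\<close> is exactly what is
  consumed. In the formula for \<open>a\<close>, the factor \<open>\<gamma>\<close> comes from
  \<open>(q\<^sup>2 - q) / 2 = - q * \<gamma> / 2\<close> with \<open>q = 1 - \<gamma>\<close>: this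
  is the growth rate of \<open>E (J (W t))\<close> per unit of \<open>s\<^sup>2\<close>, and the
  aggregator has to offset it.\<close>

definition square_integrable :: "'a measure \<Rightarrow> ('a \<Rightarrow> real) \<Rightarrow> bool" where
  "square_integrable N f \<longleftrightarrow> f \<in> borel_measurable N \<and> integrable N (\<lambda>x. (f x)\<^sup>2)"

lemma square_integrable_measurable: "square_integrable N f \<Longrightarrow> f \<in> borel_measurable N"
  by (simp add: square_integrable_def)

lemma square_integrable_mult:
  assumes "square_integrable N f" "square_integrable N g"
  shows "integrable N (\<lambda>x. f x * g x)"
proof (rule Bochner_Integration.integrable_bound)
  show "integrable N (\<lambda>x. (f x)\<^sup>2 + (g x)\<^sup>2)"
    using assms by (auto simp: square_integrable_def)
  show "(\<lambda>x. f x * g x) \<in> borel_measurable N"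
    using assms by (auto simp: square_integrable_def)
  have "\<bar>a * b\<bar> \<le> a\<^sup>2 + b\<^sup>2" for a b :: real
  proof -
    have "2 * \<bar>a * b\<bar> \<le> a\<^sup>2 + b\<^sup>2"
      using sum_squares_bound[of "\<bar>a\<bar>" "\<bar>b\<bar>"] by (simp add: abs_mult)
    then show ?thesis using abs_ge_zero[of "a * b"] by linarith
  qed
  then show "AE x in N. norm (f x * g x) \<le> norm ((f x)\<^sup>2 + (g x)\<^sup>2)"
    by auto
qed

lemma square_integrable_cmult:
  "square_integrable N f \<Longrightarrow> square_integrable N (\<lambda>x. c * f x)"
  by (auto simp: square_integrable_def power_mult_distrib)

lemma square_integrable_add:
  assumes "square_integrable N f" "square_integrable N g"
  shows "square_integrable N (\<lambda>x. f x + g x)"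
  using assms square_integrable_mult[OF assms]
  by (auto simp: square_integrable_def power2_sum mult.assoc)

lemma square_integrable_diff:
  assumes "square_integrable N f" "square_integrable N g"
  shows "square_integrable N (\<lambda>x. f x - g x)"
  using square_integrable_add[OF assms(1) square_integrable_cmult[OF assms(2), of "-1"]] by simp

lemma square_integrable_sum:
  assumes "finite I" "\<And>i. i \<in> I \<Longrightarrow> square_integrable N (f i)"
  shows "square_integrable N (\<lambda>x. \<Sum>i\<in>I. f i x)"
  using assms
proof (induction I rule: finite_induct)
  case empty
  then show ?case by (simp add: square_integrable_def)
next
  case (insert i I)
  then show ?case by (simp add: square_integrable_add)
qed

lemma (in finite_measure) square_integrable_const: "square_integrable M (\<lambda>x. c)"
  by (simp add: square_integrable_def)

lemma (in finite_measure) square_integrable_imp_integrable: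
  "square_integrable M f \<Longrightarrow> integrable M f"
  using square_integrable_mult[OF _ square_integrable_const[of 1]] by fastforce

lemma square_integrable_cong_AE:
  assumes "square_integrable N f" "g \<in> borel_measurable N" "AE x in N. f x = g x"
  shows "square_integrable N g"
proof -
  have "integrable N (\<lambda>x. (g x)\<^sup>2)"
    by (rule integrable_cong_AE_imp[of _ "\<lambda>x. (f x)\<^sup>2"]) (use assms in \<open>auto simp: square_integrable_def\<close>)
  then show ?thesis
    using assms by (simp add: square_integrable_def)
qed

lemma square_integrable_iff_nn_integral:
  assumes "f \<in> borel_measurable N"
  shows "square_integrable N f \<longleftrightarrow> (\<integral>\<^sup>+x. ennreal ((f x)\<^sup>2) \<partial>N) < \<infinity>"
  using assms by (auto simp: square_integrable_def integrable_iff_bounded)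

text \<open>The squared norm of \<open>u * f + v * g\<close> is a nonnegative quadratic form in
  \<open>u\<close> and \<open>v\<close>; the inequality is its discriminant condition.\<close>

lemma Cauchy_Schwarz_integral:
  assumes f: "square_integrable N f" and g: "square_integrable N g"
  shows "(\<integral>x. f x * g x \<partial>N)\<^sup>2 \<le> (\<integral>x. (f x)\<^sup>2 \<partial>N) * (\<integral>x. (g x)\<^sup>2 \<partial>N)"
proof -
  let ?A = "\<integral>x. (f x)\<^sup>2 \<partial>N" and ?B = "\<integral>x. f x * g x \<partial>N" and ?C = "\<integral>x. (g x)\<^sup>2 \<partial>N"
  have nonneg: "0 \<le> u\<^sup>2 * ?A + 2 * (u * v) * ?B + v\<^sup>2 * ?C" for u v
  proof -
    have "0 \<le> (\<integral>x. (u * f x + v * g x)\<^sup>2 \<partial>N)" by simp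
    also have "\<dots> = (\<integral>x. u\<^sup>2 * (f x)\<^sup>2 + 2 * (u * v) * (f x * g x) + v\<^sup>2 * (g x)\<^sup>2 \<partial>N)"
      by (rule Bochner_Integration.integral_cong) (auto simp: power2_eq_square algebra_simps)
    also have "\<dots> = u\<^sup>2 * ?A + 2 * (u * v) * ?B + v\<^sup>2 * ?C"
      using square_integrable_mult[OF f g] f g by (simp add: square_integrable_def)
    finally show ?thesis .
  qed
  have C: "0 \<le> ?C" by simp
  show ?thesis
  proof (cases "?C = 0")
    case False
    \<comment> \<open>This is the value of the form at \<open>u = ?C\<close>,
      \<open>v = - ?B\<close>.\<close>
    have "0 \<le> ?C * (?A * ?C - ?B\<^sup>2)"
      using nonneg[of ?C "- ?B"] by (simp add: power2_eq_square algebra_simps)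
    then show ?thesis
      using False C by (simp add: zero_le_mult_iff)
  next
    case True
    have "?B = 0"
    proof (rule ccontr)
      assume B: "?B \<noteq> 0"
      \<comment> \<open>For \<open>?C = 0\<close> and \<open>u = 1\<close> the form is affine in
        \<open>v\<close>; this \<open>v\<close> is chosen to give the value
        \<open>- 1\<close>.\<close>
      have "0 \<le> ?A + 2 * (- (?A + 1) / (2 * ?B)) * ?B"
        using nonneg[of 1 "- (?A + 1) / (2 * ?B)"] unfolding True by simp
      also have "\<dots> = - 1" using B by (simp add: field_simps)
      finally show False by simp
    qed
    then show ?thesis using True by simp
  qed
qed

text \<open>Distances are nonnegative integrals, as in \<open>has_ito_integral\<close>, so they make
  sense before \<open>g\<close> is known to be square integrable. One \<open>f m\<close> at finite
  distance puts \<open>g\<close> into the space; the remaining claims are continuity of the inner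
  product and of the norm.\<close>

lemma square_integrable_limit:
  assumes f: "\<And>m. square_integrable N (f m)" and g: "g \<in> borel_measurable N"
    and lim: "(\<lambda>m. \<integral>\<^sup>+x. ennreal ((f m x - g x)\<^sup>2) \<partial>N) \<longlonglongrightarrow> 0"
  shows "square_integrable N g"
    and "square_integrable N h \<Longrightarrow> (\<lambda>m. \<integral>x. f m x * h x \<partial>N) \<longlonglongrightarrow> (\<integral>x. g x * h x \<partial>N)"
    and "(\<lambda>m. \<integral>x. (f m x)\<^sup>2 \<partial>N) \<longlonglongrightarrow> (\<integral>x. (g x)\<^sup>2 \<partial>N)"
proof -
  have fm: "f m \<in> borel_measurable N" for m
    using f by (rule square_integrable_measurable)
  have "eventually (\<lambda>m. (\<integral>\<^sup>+x. ennreal ((f m x - g x)\<^sup>2) \<partial>N) < 1) sequentially"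
    using lim by (rule order_tendstoD) simp
  then obtain m where "(\<integral>\<^sup>+x. ennreal ((f m x - g x)\<^sup>2) \<partial>N) < 1"
    by (auto simp: eventually_sequentially)
  then have "(\<integral>\<^sup>+x. ennreal ((f m x - g x)\<^sup>2) \<partial>N) < \<infinity>"
    by (rule less_trans) simp
  then have "square_integrable N (\<lambda>x. f m x - g x)"
    using fm g by (subst square_integrable_iff_nn_integral) auto
  from square_integrable_diff[OF f[of m] this] show g2: "square_integrable N g" by simp
  have d: "square_integrable N (\<lambda>x. f m x - g x)" for m
    by (rule square_integrable_diff[OF f g2])
  have dlim: "(\<lambda>m. \<integral>x. (f m x - g x)\<^sup>2 \<partial>N) \<longlonglongrightarrow> 0"
  proof -
    have "(\<integral>\<^sup>+x. ennreal ((f m x - g x)\<^sup>2) \<partial>N) = ennreal (\<integral>x. (f m x - g x)\<^sup>2 \<partial>N)" for m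
      using d by (intro nn_integral_eq_integral) (auto simp: square_integrable_def)
    with lim have "(\<lambda>m. ennreal (\<integral>x. (f m x - g x)\<^sup>2 \<partial>N)) \<longlonglongrightarrow> ennreal 0" by simp
    then show ?thesis by (rule tendsto_ennrealD) auto
  qed
  have inner: "(\<lambda>m. \<integral>x. f m x * h x \<partial>N) \<longlonglongrightarrow> (\<integral>x. g x * h x \<partial>N)" if h: "square_integrable N h" for h
  proof -
    have "(\<lambda>m. (\<integral>x. (f m x - g x) * h x \<partial>N)\<^sup>2) \<longlonglongrightarrow> 0"
    proof (rule tendsto_sandwich[OF _ _ tendsto_const])
      show "(\<lambda>m. (\<integral>x. (f m x - g x)\<^sup>2 \<partial>N) * (\<integral>x. (h x)\<^sup>2 \<partial>N)) \<longlonglongrightarrow> 0"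
        using tendsto_mult[OF dlim tendsto_const] by simp
      show "\<forall>\<^sub>F m in sequentially. (\<integral>x. (f m x - g x) * h x \<partial>N)\<^sup>2
          \<le> (\<integral>x. (f m x - g x)\<^sup>2 \<partial>N) * (\<integral>x. (h x)\<^sup>2 \<partial>N)"
        by (intro always_eventually allI Cauchy_Schwarz_integral d h)
    qed simp
    then have "(\<lambda>m. \<integral>x. (f m x - g x) * h x \<partial>N) \<longlonglongrightarrow> 0"
      by (simp add: power_tendsto_0_iff)
    moreover have "(\<integral>x. (f m x - g x) * h x \<partial>N) = (\<integral>x. f m x * h x \<partial>N) - (\<integral>x. g x * h x \<partial>N)" for m
      using square_integrable_mult[OF f h] square_integrable_mult[OF g2 h] by (simp add: left_diff_distrib)
    ultimately show ?thesis
      using LIM_zero_cancel by force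
  qed
  then show "square_integrable N h \<Longrightarrow> (\<lambda>m. \<integral>x. f m x * h x \<partial>N) \<longlonglongrightarrow> (\<integral>x. g x * h x \<partial>N)" .
  \<comment> \<open>Polarization reduces the norm to the distance from \<open>g\<close> and the
    inner product with \<open>g\<close>, whose limits are known.\<close>
  have "(\<integral>x. (f m x)\<^sup>2 \<partial>N) = (\<integral>x. (f m x - g x)\<^sup>2 \<partial>N) + 2 * (\<integral>x. f m x * g x \<partial>N) - (\<integral>x. (g x)\<^sup>2 \<partial>N)" for m
  proof -
    have "(\<integral>x. (f m x)\<^sup>2 \<partial>N) = (\<integral>x. (f m x - g x)\<^sup>2 + 2 * (f m x * g x) - (g x)\<^sup>2 \<partial>N)"
      by (rule Bochner_Integration.integral_cong) (auto simp: power2_eq_square algebra_simps)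
    also have "\<dots> = (\<integral>x. (f m x - g x)\<^sup>2 \<partial>N) + 2 * (\<integral>x. f m x * g x \<partial>N) - (\<integral>x. (g x)\<^sup>2 \<partial>N)"
      using square_integrable_mult[OF f[of m] g2] d[of m] g2
      by (subst Bochner_Integration.integral_diff Bochner_Integration.integral_add
            | simp add: square_integrable_def)+
    finally show ?thesis .
  qed
  moreover have "(\<lambda>m. (\<integral>x. (f m x - g x)\<^sup>2 \<partial>N) + 2 * (\<integral>x. f m x * g x \<partial>N) - (\<integral>x. (g x)\<^sup>2 \<partial>N))
      \<longlonglongrightarrow> 0 + 2 * (\<integral>x. g x * g x \<partial>N) - (\<integral>x. (g x)\<^sup>2 \<partial>N)"
    by (intro tendsto_intros dlim inner g2)
  ultimately show "(\<lambda>m. \<integral>x. (f m x)\<^sup>2 \<partial>N) \<longlonglongrightarrow> (\<integral>x. (g x)\<^sup>2 \<partial>N)"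
    by (simp add: power2_eq_square)
qed

text \<open>Regularity is bootstrapped from mere integrability: the integral is continuous in
  \<open>t\<close>, hence so is \<open>u\<close>, hence \<open>u\<close> is differentiable, and
  \<open>u t * exp (- (k * t))\<close> has derivative zero.\<close>

lemma linear_integral_equation:
  fixes u :: "real \<Rightarrow> real"
  assumes "0 \<le> T" and int: "set_integrable lborel {0..T} u"
    and eq: "\<And>t. 0 \<le> t \<Longrightarrow> t \<le> T \<Longrightarrow> u t = c + k * (LBINT s:{0..t}. u s)"
  shows "u T = c * exp (k * T)"
proof -
  have sub: "set_integrable lborel {0..t} u" if "t \<le> T" for t
    using set_integrable_subset[OF int, of "{0..t}"] that by auto
  have eq': "u t = c + k * integral {0..t} u" if "t \<in> {0..T}" for t
    using eq[of t] set_borel_integral_eq_integral(2)[OF sub[of t]] that by simp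
  have "continuous_on {0..T} (\<lambda>t. integral {0..t} u)"
    using set_borel_integral_eq_integral(1)[OF int] by (rule indefinite_integral_continuous_1)
  then have "continuous_on {0..T} (\<lambda>t. c + k * integral {0..t} u)"
    by (intro continuous_intros)
  then have cont: "continuous_on {0..T} u"
    by (rule continuous_on_eq) (simp add: eq')
  have deriv: "((\<lambda>t. c + k * integral {0..t} u) has_real_derivative k * u t) (at t within {0..T})"
    if "t \<in> {0..T}" for t
    using integral_has_real_derivative[OF cont that] by (auto intro!: derivative_eq_intros)
  have deriv_u: "(u has_real_derivative k * u t) (at t within {0..T})" if "t \<in> {0..T}" for t
    by (rule has_field_derivative_transform_within[OF deriv[OF that], of 1]) (use that eq' in auto)
  have "u T * exp (- (k * T)) = c"
  \<comment> \<open>The constancy criterion needs a nondegenerate interval.\<close>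
  proof (cases "T = 0")
    case True
    then show ?thesis using eq'[of 0] by simp
  next
    case False
    have "u T * exp (- (k * T)) = u 0 * exp (- (k * 0))"
    proof (rule DERIV_isconst_end[where f = "\<lambda>t. u t * exp (- (k * t))"])
      show "continuous_on {0..T} (\<lambda>t. u t * exp (- (k * t)))"
        by (intro continuous_intros cont)
      fix t assume t: "0 < t" "t < T"
      have "((\<lambda>t. u t * exp (- (k * t))) has_real_derivative
          k * u t * exp (- (k * t)) + - k * exp (- (k * t)) * u t) (at t within {0..T})"
        using deriv_u[of t] t by (auto intro!: derivative_eq_intros)
      then show "((\<lambda>t. u t * exp (- (k * t))) has_real_derivative 0) (at t)"
        using t at_within_Icc_at[of 0 t T] by (simp add: mult.commute mult.left_commute)
    qed (use False assms in simp)
    then show ?thesis using eq'[of 0] assms by simp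
  qed
  then show ?thesis by (simp add: exp_minus field_simps)
qed

text \<open>Completing the square: an exponential weight shifts the mean of a centered normal law by
  \<open>\<theta> * \<sigma>\<^sup>2\<close>. This is where the change of measure enters.\<close>

lemma normal_density_mult_exp:
  assumes "\<sigma> > 0"
  shows "normal_density 0 \<sigma> x * exp (\<theta> * x) = exp (\<theta>\<^sup>2 * \<sigma>\<^sup>2 / 2) * normal_density (\<theta> * \<sigma>\<^sup>2) \<sigma> x"
proof -
  have "- x\<^sup>2 / (2 * \<sigma>\<^sup>2) + \<theta> * x = \<theta>\<^sup>2 * \<sigma>\<^sup>2 / 2 + - (x - \<theta> * \<sigma>\<^sup>2)\<^sup>2 / (2 * \<sigma>\<^sup>2)"
    using assms by (simp add: field_simps power2_eq_square)
  then have "exp (- x\<^sup>2 / (2 * \<sigma>\<^sup>2)) * exp (\<theta> * x)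
      = exp (\<theta>\<^sup>2 * \<sigma>\<^sup>2 / 2) * exp (- (x - \<theta> * \<sigma>\<^sup>2)\<^sup>2 / (2 * \<sigma>\<^sup>2))"
    by (metis exp_add)
  from arg_cong[OF this, of "\<lambda>y. 1 / sqrt (2 * pi * \<sigma>\<^sup>2) * y"] show ?thesis
    unfolding normal_density_def by (simp only: diff_zero mult.assoc mult.left_commute)
qed

text \<open>After the shift, the two values are total mass and mean of the normal law around
  \<open>\<theta> * \<sigma>\<^sup>2\<close>, times the normalizing factor.\<close>

lemma
  assumes "\<sigma> > 0"
  shows normal_exp_moment: "has_bochner_integral lborel (\<lambda>x. normal_density 0 \<sigma> x * exp (\<theta> * x)) (exp (\<theta>\<^sup>2 * \<sigma>\<^sup>2 / 2))"
    and normal_exp_moment_1: "has_bochner_integral lborel (\<lambda>x. normal_density 0 \<sigma> x * (x * exp (\<theta> * x)))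
           (exp (\<theta>\<^sup>2 * \<sigma>\<^sup>2 / 2) * (\<theta> * \<sigma>\<^sup>2))"
proof -
  have "has_bochner_integral lborel (\<lambda>x. exp (\<theta>\<^sup>2 * \<sigma>\<^sup>2 / 2) * normal_density (\<theta> * \<sigma>\<^sup>2) \<sigma> x) (exp (\<theta>\<^sup>2 * \<sigma>\<^sup>2 / 2) * 1)"
    using assms by (intro has_bochner_integral_mult_right) (auto simp: has_bochner_integral_iff)
  then show "has_bochner_integral lborel (\<lambda>x. normal_density 0 \<sigma> x * exp (\<theta> * x)) (exp (\<theta>\<^sup>2 * \<sigma>\<^sup>2 / 2))"
    by (simp add: normal_density_mult_exp[OF assms])
  have "has_bochner_integral lborel (\<lambda>x. exp (\<theta>\<^sup>2 * \<sigma>\<^sup>2 / 2) * (normal_density (\<theta> * \<sigma>\<^sup>2) \<sigma> x * x))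
      (exp (\<theta>\<^sup>2 * \<sigma>\<^sup>2 / 2) * (\<theta> * \<sigma>\<^sup>2))"
    using assms by (intro has_bochner_integral_mult_right normal_moment_nz_1)
  moreover have "normal_density 0 \<sigma> x * (x * exp (\<theta> * x))
      = exp (\<theta>\<^sup>2 * \<sigma>\<^sup>2 / 2) * (normal_density (\<theta> * \<sigma>\<^sup>2) \<sigma> x * x)" for x
    using arg_cong[OF normal_density_mult_exp[OF assms, of x \<theta>], of "\<lambda>y. x * y"]
    by (simp only: mult.assoc mult.left_commute mult.commute)
  ultimately show "has_bochner_integral lborel (\<lambda>x. normal_density 0 \<sigma> x * (x * exp (\<theta> * x)))
      (exp (\<theta>\<^sup>2 * \<sigma>\<^sup>2 / 2) * (\<theta> * \<sigma>\<^sup>2))"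
    by (simp only:)
qed

subsection \<open>Brownian motion and the Ito integral\<close>

locale brownian =
  fixes M :: "'s measure" and \<F> :: "real \<Rightarrow> 's measure" and B :: "real \<Rightarrow> 's \<Rightarrow> real"
  assumes brownian: "brownian_motion M \<F> B"

sublocale brownian \<subseteq> prob_space M
  using brownian by (simp add: brownian_motion_def)

context brownian
begin

lemma subalgebra_filtration: "subalgebra M (\<F> t)"
  using brownian by (simp add: brownian_motion_def)

lemma space_filtration [simp]: "space (\<F> t) = space M"
  using subalgebra_filtration by (simp add: subalgebra_def)

lemma measurable_filtration: "f \<in> borel_measurable (\<F> t) \<Longrightarrow> f \<in> borel_measurable M"
  using measurable_from_subalg[OF subalgebra_filtration] .

lemma measurable_filtration_mono:
  assumes "s \<le> t" "f \<in> borel_measurable (\<F> s)"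
  shows "f \<in> borel_measurable (\<F> t)"
proof -
  have "filtration (space M) \<F>"
    using brownian by (simp add: brownian_motion_def)
  then have "sets (\<F> s) \<subseteq> sets (\<F> t)"
    using assms(1) by (simp add: filtration_def)
  then have "subalgebra (\<F> t) (\<F> s)"
    by (simp add: subalgebra_def)
  then show ?thesis
    using assms(2) by (rule measurable_from_subalg)
qed

lemma measurable_B: "0 \<le> t \<Longrightarrow> B t \<in> borel_measurable (\<F> t)"
  using brownian by (simp add: brownian_motion_def)

lemma measurable_B_le: "0 \<le> s \<Longrightarrow> s \<le> t \<Longrightarrow> B s \<in> borel_measurable (\<F> t)"
  using measurable_B measurable_filtration_mono by blast

lemma measurable_B_M: "0 \<le> t \<Longrightarrow> B t \<in> borel_measurable M"
  using measurable_B measurable_filtration by blast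

lemma B_0: "AE x in M. B 0 x = 0"
  using brownian by (simp add: brownian_motion_def)

text \<open>The increment is independent of \<open>\<F> s\<close>, so the expectation factors;
  \<open>c\<close> is the Gaussian integral of \<open>g\<close>. All later facts on expectations
  involving increments come from suitable choices of \<open>g\<close>.\<close>

lemma integral_mult_increment:
  assumes st: "0 \<le> s" "s < t" and Y: "Y \<in> borel_measurable (\<F> s)" "integrable M Y"
    and g: "g \<in> borel_measurable borel"
    and c: "has_bochner_integral lborel (\<lambda>x. normal_density 0 (sqrt (t - s)) x * g x) c"
  shows "has_bochner_integral M (\<lambda>x. Y x * g (B t x - B s x)) ((\<integral>x. Y x \<partial>M) * c)"
proof -
  let ?D = "\<lambda>x. B t x - B s x"
  have D: "?D \<in> borel_measurable M"
    using measurable_B_M[of s] measurable_B_M[of t] st by auto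
  have dist: "distributed M lborel ?D (normal_density 0 (sqrt (t - s)))"
    and ind: "indep_set (sets (\<F> s)) (sets (vimage_algebra (space M) ?D borel))"
    using brownian st by (simp_all add: brownian_motion_def)
  \<comment> \<open>Independence is assumed for all of \<open>\<F> s\<close>; it passes to the
    smaller sigma-algebra generated by \<open>Y\<close>.\<close>
  have "sigma_sets (space M) {Y -` A \<inter> space M |A. A \<in> sets borel} \<subseteq> sets (\<F> s)"
  proof -
    have "{Y -` A \<inter> space M |A. A \<in> sets borel} \<subseteq> sets (\<F> s)"
      using measurable_sets[OF Y(1)] by auto
    from sets.sigma_sets_subset[OF this] show ?thesis by simp
  qed
  then have "indep_var borel Y borel ?D"
    using ind Y D unfolding indep_var_eq sets_vimage_algebra indep_sets2_eq
    by (auto intro: borel_measurable_integrable)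
  from indep_var_compose[OF this, of "\<lambda>x. x" borel g borel] g
  have iv: "indep_var borel Y borel (\<lambda>x. g (?D x))"
    by (simp add: comp_def)
  have gm: "g \<in> borel_measurable lborel" using g by simp
  have int: "integrable M (\<lambda>x. g (?D x))"
    using distributed_integrable[OF dist gm] c by (auto simp: has_bochner_integral_iff)
  have val: "(\<integral>x. g (?D x) \<partial>M) = c"
    using distributed_integral[OF dist gm] c by (auto simp: has_bochner_integral_iff)
  show ?thesis
    using indep_var_integrable[OF iv Y(2) int] indep_var_lebesgue_integral[OF iv Y(2) int] val
    by (simp add: has_bochner_integral_iff)
qed

text \<open>Split \<open>B t\<close> into \<open>B s\<close> and an independent increment, whose
  exponential moment is the extra factor. The case \<open>s = t\<close> is separate because a
  degenerate increment has no density.\<close>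

lemma integral_mult_exp:
  assumes st: "0 \<le> s" "s \<le> t" and Y: "Y \<in> borel_measurable (\<F> s)"
    and int: "integrable M (\<lambda>x. Y x * exp (\<theta> * B s x))"
  shows "has_bochner_integral M (\<lambda>x. Y x * exp (\<theta> * B t x))
           ((\<integral>x. Y x * exp (\<theta> * B s x) \<partial>M) * exp (\<theta>\<^sup>2 * (t - s) / 2))"
proof (cases "s = t")
  case True
  then show ?thesis using int by (simp add: has_bochner_integral_iff)
next
  case False
  have "has_bochner_integral M (\<lambda>x. (Y x * exp (\<theta> * B s x)) * exp (\<theta> * (B t x - B s x)))
      ((\<integral>x. Y x * exp (\<theta> * B s x) \<partial>M) * exp (\<theta>\<^sup>2 * (sqrt (t - s))\<^sup>2 / 2))"
    using False st Y measurable_B[OF st(1)]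
    by (intro integral_mult_increment int normal_exp_moment) auto
  moreover have "(Y x * exp (\<theta> * B s x)) * exp (\<theta> * (B t x - B s x)) = Y x * exp (\<theta> * B t x)" for x
    by (simp add: right_diff_distrib mult.assoc flip: exp_add)
  ultimately show ?thesis using st by simp
qed

text \<open>Same splitting, now with the first exponential moment of the increment, which
  contributes the factor \<open>\<theta> * (t - s)\<close>.\<close>

lemma integral_mult_increment_exp:
  assumes st: "0 \<le> s" "s \<le> t" and Y: "Y \<in> borel_measurable (\<F> s)"
    and int: "integrable M (\<lambda>x. Y x * exp (\<theta> * B s x))"
  shows "has_bochner_integral M (\<lambda>x. Y x * (B t x - B s x) * exp (\<theta> * B t x))
           ((\<integral>x. Y x * exp (\<theta> * B s x) \<partial>M) * (exp (\<theta>\<^sup>2 * (t - s) / 2) * (\<theta> * (t - s))))"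
proof (cases "s = t")
  case True
  then show ?thesis by (simp add: has_bochner_integral_zero)
next
  case False
  have "has_bochner_integral M
      (\<lambda>x. (Y x * exp (\<theta> * B s x)) * ((B t x - B s x) * exp (\<theta> * (B t x - B s x))))
      ((\<integral>x. Y x * exp (\<theta> * B s x) \<partial>M) * (exp (\<theta>\<^sup>2 * (sqrt (t - s))\<^sup>2 / 2) * (\<theta> * (sqrt (t - s))\<^sup>2)))"
    using False st Y measurable_B[OF st(1)]
    by (intro integral_mult_increment[where g = "\<lambda>x. x * exp (\<theta> * x)"] int normal_exp_moment_1) auto
  moreover have "(Y x * exp (\<theta> * B s x)) * ((B t x - B s x) * exp (\<theta> * (B t x - B s x)))
      = Y x * (B t x - B s x) * exp (\<theta> * B t x)" for x
  proof -
    have "exp (\<theta> * B s x) * exp (\<theta> * (B t x - B s x)) = exp (\<theta> * B t x)"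
      by (simp add: right_diff_distrib flip: exp_add)
    then show ?thesis by (metis mult.assoc mult.left_commute)
  qed
  ultimately show ?thesis using st by simp
qed

lemma has_bochner_integral_exp_B:
  assumes "0 \<le> t"
  shows "has_bochner_integral M (\<lambda>x. exp (\<theta> * B t x)) (exp (\<theta>\<^sup>2 * t / 2))"
proof -
  \<comment> \<open>Starting value for \<open>integral_mult_exp\<close>; \<open>B 0\<close> vanishes
    only almost surely.\<close>
  have 1: "has_bochner_integral M (\<lambda>x. exp (\<theta> * B 0 x)) 1"
  proof -
    have "has_bochner_integral M (\<lambda>x. 1 :: real) 1"
      by (simp add: has_bochner_integral_iff prob_space)
    moreover have "AE x in M. 1 = exp (\<theta> * B 0 x)" using B_0 by eventually_elim simp
    ultimately show ?thesis
      using has_bochner_integral_cong_AE[of "\<lambda>x. 1" M "\<lambda>x. exp (\<theta> * B 0 x)" 1] measurable_B_M[of 0] by simp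
  qed
  then show ?thesis
    using integral_mult_exp[of 0 t "\<lambda>x. 1" \<theta>] assms by (simp add: has_bochner_integral_iff)
qed

lemma square_integrable_exp_B:
  assumes "0 \<le> t"
  shows "square_integrable M (\<lambda>x. exp (\<theta> * B t x))"
proof -
  have "(exp (\<theta> * B t x))\<^sup>2 = exp ((2 * \<theta>) * B t x)" for x
    by (simp add: power2_eq_square flip: exp_add)
  then show ?thesis
    using has_bochner_integral_exp_B[OF assms, of "2 * \<theta>"] measurable_B_M[OF assms]
    by (auto simp: square_integrable_def has_bochner_integral_iff)
qed

text \<open>The Ito isometry on one interval: the squared increment is independent of
  \<open>Y\<close> and has mean \<open>t - s\<close>.\<close>

lemma square_integrable_mult_increment:
  assumes st: "0 \<le> s" "s \<le> t" and Y: "Y \<in> borel_measurable (\<F> s)" "square_integrable M Y"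
  shows "square_integrable M (\<lambda>x. Y x * (B t x - B s x))"
    and "(\<integral>x. (Y x * (B t x - B s x))\<^sup>2 \<partial>M) = (\<integral>x. (Y x)\<^sup>2 \<partial>M) * (t - s)"
proof -
  have "has_bochner_integral M (\<lambda>x. (Y x * (B t x - B s x))\<^sup>2) ((\<integral>x. (Y x)\<^sup>2 \<partial>M) * (t - s))"
  proof (cases "s = t")
    case True
    then show ?thesis by (simp add: has_bochner_integral_zero)
  next
    case False
    have "has_bochner_integral M (\<lambda>x. (Y x)\<^sup>2 * (B t x - B s x)\<^sup>2) ((\<integral>x. (Y x)\<^sup>2 \<partial>M) * (t - s))"
    proof (rule integral_mult_increment)
      show "has_bochner_integral lborel (\<lambda>x. normal_density 0 (sqrt (t - s)) x * x\<^sup>2) (t - s)"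
        using normal_moment_even[of "sqrt (t - s)" 0 1] st False by (simp add: diff_divide_distrib)
    qed (use Y st False in \<open>auto simp: square_integrable_def\<close>)
    then show ?thesis by (simp add: power_mult_distrib)
  qed
  then show "square_integrable M (\<lambda>x. Y x * (B t x - B s x))"
    and "(\<integral>x. (Y x * (B t x - B s x))\<^sup>2 \<partial>M) = (\<integral>x. (Y x)\<^sup>2 \<partial>M) * (t - s)"
    using measurable_B_M[of s] measurable_B_M[of t] Y st
    by (auto simp: square_integrable_def has_bochner_integral_iff)
qed

text \<open>Everything except the later increment is measurable at its left end \<open>s'\<close>,
  and that increment is independent of it with mean zero.\<close>

lemma integral_increments_orthogonal:
  assumes "0 \<le> s" "s \<le> t" "t \<le> s'" "s' \<le> t'"
    and Y: "Y \<in> borel_measurable (\<F> s)" "square_integrable M Y"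
    and Y': "Y' \<in> borel_measurable (\<F> s')" "square_integrable M Y'"
  shows "(\<integral>x. (Y x * (B t x - B s x)) * (Y' x * (B t' x - B s' x)) \<partial>M) = 0"
proof (cases "s' = t'")
  case True
  then show ?thesis by simp
next
  case False
  have Ym: "Y \<in> borel_measurable (\<F> s')"
    using Y(1) assms by (intro measurable_filtration_mono[OF _ Y(1)]) auto
  have "has_bochner_integral M (\<lambda>x. ((Y x * (B t x - B s x)) * Y' x) * (B t' x - B s' x))
      ((\<integral>x. (Y x * (B t x - B s x)) * Y' x \<partial>M) * 0)"
  proof (rule integral_mult_increment[where g = "\<lambda>x. x"])
    show "(\<lambda>x. Y x * (B t x - B s x) * Y' x) \<in> borel_measurable (\<F> s')"
      using Ym Y'(1) measurable_B_le[of t s'] measurable_B_le[of s s'] assms by auto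
    show "integrable M (\<lambda>x. Y x * (B t x - B s x) * Y' x)"
      using assms by (intro square_integrable_mult square_integrable_mult_increment(1)) auto
    show "has_bochner_integral lborel (\<lambda>x. normal_density 0 (sqrt (t' - s')) x * x) 0"
      using assms False by (intro normal_moment_nz_1) simp
  qed (use assms False in auto)
  then show ?thesis
    by (simp add: has_bochner_integral_iff mult.assoc)
qed

text \<open>Under the weight \<open>exp (\<theta> * B T x)\<close> Brownian motion has drift
  \<open>\<theta>\<close>, so the increment may be replaced by \<open>\<theta> * (t - s)\<close>.
  Both sides are computed as multiples of the expectation of
  \<open>Y x * exp (\<theta> * B s x)\<close>.\<close>

lemma integral_increment_mult_exp_B:
  assumes st: "0 \<le> s" "s \<le> t" "t \<le> T"
    and Y: "Y \<in> borel_measurable (\<F> s)" "square_integrable M Y"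
  shows "(\<integral>x. (Y x * (B t x - B s x)) * exp (\<theta> * B T x) \<partial>M)
           = \<theta> * (t - s) * (\<integral>x. Y x * exp (\<theta> * B T x) \<partial>M)"
proof -
  have int: "integrable M (\<lambda>x. Y x * exp (\<theta> * B s x))"
    using st Y by (intro square_integrable_mult square_integrable_exp_B) auto
  have Yt: "Y \<in> borel_measurable (\<F> t)"
    using st by (intro measurable_filtration_mono[OF _ Y(1)])
  have m: "(\<lambda>x. Y x * (B t x - B s x)) \<in> borel_measurable (\<F> t)"
    using Yt measurable_B_le[of t t] measurable_B_le[of s t] st by auto
  note 1 = integral_mult_increment_exp[OF st(1,2) Y(1) int]
  \<comment> \<open>The increment lies before \<open>t\<close>, so moving the exponential from
    \<open>t\<close> to \<open>T\<close> costs only a constant factor.\<close>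
  have 2: "has_bochner_integral M (\<lambda>x. Y x * (B t x - B s x) * exp (\<theta> * B T x))
      ((\<integral>x. Y x * (B t x - B s x) * exp (\<theta> * B t x) \<partial>M) * exp (\<theta>\<^sup>2 * (T - t) / 2))"
    using 1 st by (intro integral_mult_exp m) (auto simp: has_bochner_integral_iff)
  have 3: "has_bochner_integral M (\<lambda>x. Y x * exp (\<theta> * B T x))
      ((\<integral>x. Y x * exp (\<theta> * B s x) \<partial>M) * exp (\<theta>\<^sup>2 * (T - s) / 2))"
    using st by (intro integral_mult_exp Y int) auto
  have "exp (\<theta>\<^sup>2 * (T - s) / 2) = exp (\<theta>\<^sup>2 * (t - s) / 2) * exp (\<theta>\<^sup>2 * (T - t) / 2)"
    by (simp add: algebra_simps add_divide_distrib diff_divide_distrib flip: exp_add)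
  with 1 2 3 show ?thesis
    by (simp add: has_bochner_integral_iff)
qed

end

section \<open>The product of a time interval and the probability space\<close>

lemma (in pair_sigma_finite) has_bochner_integral_product:
  fixes f :: "'a \<Rightarrow> real" and g :: "'b \<Rightarrow> real"
  assumes f: "integrable M1 f" and g: "integrable M2 g"
  shows "has_bochner_integral (M1 \<Otimes>\<^sub>M M2) (\<lambda>(x, y). f x * g y) ((\<integral>x. f x \<partial>M1) * (\<integral>y. g y \<partial>M2))"
proof -
  have [measurable]: "f \<in> borel_measurable M1" "g \<in> borel_measurable M2"
    using f g by auto
  have int: "integrable (M1 \<Otimes>\<^sub>M M2) (\<lambda>(x, y). f x * g y)"
  proof (rule Fubini_integrable)
    show "integrable M1 (\<lambda>x. \<integral>y. norm (case (x, y) of (x, y) \<Rightarrow> f x * g y) \<partial>M2)"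
      using f g by (simp add: abs_mult)
  qed (use g in auto)
  then show ?thesis
    using integral_fst'[OF int] by (simp add: has_bochner_integral_iff)
qed

abbreviation time_interval :: "real \<Rightarrow> real measure" where
  "time_interval T \<equiv> restrict_space lborel {0..T}"

lemma finite_measure_time_interval: "finite_measure (time_interval T)"
  by (rule finite_measureI) (simp add: space_restrict_space emeasure_restrict_space emeasure_lborel_Icc_eq)

lemma has_bochner_integral_indicator_time_interval:
  assumes "0 \<le> a" "a \<le> b" "b \<le> T"
  shows "has_bochner_integral (time_interval T) (indicator {a<..b} :: real \<Rightarrow> real) (b - a)"
proof -
  have "has_bochner_integral lborel (\<lambda>x. indicator {0..T} x *\<^sub>R (indicator {a<..b} x :: real)) (b - a)"
  proof -
    have "(\<lambda>x. indicator {0..T} x *\<^sub>R (indicator {a<..b} x :: real)) = indicator {a<..b}"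
      using assms by (auto split: split_indicator)
    then show ?thesis using assms by (simp add: has_bochner_integral_iff)
  qed
  moreover have Icc: "{0..T} \<inter> space lborel \<in> sets lborel" by simp
  ultimately show ?thesis
    by (simp only: has_bochner_integral_iff integrable_restrict_space[OF Icc] integral_restrict_space[OF Icc])
qed

context brownian
begin

text \<open>Integrands are elements of \<open>L2\<close> of this product: the double integral in
  \<open>has_ito_integral\<close> is a squared distance here, so one set of limit facts serves
  integrands and integrals alike.\<close>

abbreviation time_paths :: "real \<Rightarrow> (real \<times> 's) measure" where
  "time_paths T \<equiv> time_interval T \<Otimes>\<^sub>M M"

lemma pair_sigma_finite_time_paths: "pair_sigma_finite (time_interval T) M"
  using finite_measure_time_interval sigma_finite_measure_axioms
  by (intro pair_sigma_finite.intro finite_measure.axioms(1)[of "time_interval T"])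

text \<open>Enlarging \<open>\<F> T\<close> to \<open>M\<close> gives the first claim, and taking
  the section of the jointly measurable map at time \<open>T\<close> gives the second,
  adaptedness.\<close>

lemma measurable_progressive:
  assumes X: "progressive \<F> X" and T: "0 \<le> T"
  shows "(\<lambda>(s, x). X s x) \<in> borel_measurable (time_paths T)"
    and "X T \<in> borel_measurable (\<F> T)"
proof -
  have m: "(\<lambda>(s, x). X s x) \<in> borel_measurable (restrict_space borel {0..T} \<Otimes>\<^sub>M \<F> T)"
    using X T by (simp add: progressive_def)
  have "snd \<in> measurable (time_paths T) (\<F> T)"
  proof -
    have "(\<lambda>x. x) \<in> measurable M (\<F> T)"
      using measurable_from_subalg[OF subalgebra_filtration measurable_ident] by (simp add: id_def)
    then have "(\<lambda>z. snd z) \<in> measurable (time_paths T) (\<F> T)"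
      by (rule measurable_compose[OF measurable_snd])
    then show ?thesis by simp
  qed
  moreover have "fst \<in> measurable (time_paths T) (restrict_space borel {0..T})"
    by (rule measurable_compose[OF measurable_fst])
      (simp add: measurable_restrict_space2_iff measurable_restrict_space1)
  ultimately have "(\<lambda>z. (fst z, snd z)) \<in> measurable (time_paths T) (restrict_space borel {0..T} \<Otimes>\<^sub>M \<F> T)"
    by (intro measurable_Pair)
  from measurable_compose[OF this m] show "(\<lambda>(s, x). X s x) \<in> borel_measurable (time_paths T)"
    by (simp add: case_prod_unfold)
  have "T \<in> space (restrict_space borel {0..T})" using T by (simp add: space_restrict_space)
  from measurable_compose[OF measurable_Pair1'[OF this] m] show "X T \<in> borel_measurable (\<F> T)"
    by simp
qed

section \<open>Moments of simple integrands and their integrals\<close>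

lemma simple_integrand_increasing:
  assumes "simple_integrand M \<F> T n p \<xi>" "i \<le> j" "j \<le> n"
  shows "p i \<le> p j"
  using assms(2,3)
proof (induction j rule: dec_induct)
  case (step j)
  then have "p j \<le> p (Suc j)"
    using assms(1) by (simp add: simple_integrand_def)
  with step show ?case by simp
qed simp

lemma simple_integrand_measurable:
  assumes "simple_integrand M \<F> T n p \<xi>" "i < n"
  shows "\<xi> i \<in> borel_measurable (\<F> (p i))" "square_integrable M (\<xi> i)"
    "0 \<le> p i" "p i \<le> p (Suc i)" "p (Suc i) \<le> T"
  using assms by (auto simp: simple_integrand_def square_integrable_def intro: measurable_filtration)

text \<open>Orthogonality of increments removes the cross terms, and the pairing is computed
  interval by interval. The sums on the right are those of \<open>simple_value_moments\<close>;
  comparing the two lemmas gives isometry and exponential pairing for simple integrands.\<close>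

lemma simple_integral_moments:
  assumes si: "simple_integrand M \<F> T n p \<xi>"
  shows "square_integrable M (simple_integral B n p \<xi>)"
    and "(\<integral>x. (simple_integral B n p \<xi> x)\<^sup>2 \<partial>M) = (\<Sum>i<n. (\<integral>x. (\<xi> i x)\<^sup>2 \<partial>M) * (p (Suc i) - p i))"
    and "(\<integral>x. simple_integral B n p \<xi> x * exp (\<theta> * B T x) \<partial>M)
           = \<theta> * (\<Sum>i<n. (\<integral>x. \<xi> i x * exp (\<theta> * B T x) \<partial>M) * (p (Suc i) - p i))"
proof -
  note si' = simple_integrand_measurable[OF si]
  let ?Z = "\<lambda>i x. \<xi> i x * (B (p (Suc i)) x - B (p i) x)"
  have Z: "square_integrable M (?Z i)" "(\<integral>x. (?Z i x)\<^sup>2 \<partial>M) = (\<integral>x. (\<xi> i x)\<^sup>2 \<partial>M) * (p (Suc i) - p i)"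
    if "i < n" for i
    using square_integrable_mult_increment[OF si'(3,4,1,2)] that by auto
  show S: "square_integrable M (simple_integral B n p \<xi>)"
    unfolding simple_integral_def[abs_def] by (intro square_integrable_sum Z(1)) auto
  have orth: "(\<integral>x. ?Z i x * ?Z j x \<partial>M) = 0" if "i < j" "j < n" for i j
    using that simple_integrand_increasing[OF si, of "Suc i" j]
    by (intro integral_increments_orthogonal si') auto
  have orth': "(\<integral>x. ?Z i x * ?Z j x \<partial>M) = 0" if "i \<noteq> j" "i < n" "j < n" for i j
    using that orth[of i j] orth[of j i] by (cases "i < j") (auto simp: mult.commute)
  have "(\<integral>x. (simple_integral B n p \<xi> x)\<^sup>2 \<partial>M) = (\<integral>x. (\<Sum>i<n. \<Sum>j<n. ?Z i x * ?Z j x) \<partial>M)"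
    by (simp add: simple_integral_def power2_eq_square sum_product)
  also have "\<dots> = (\<Sum>i<n. \<Sum>j<n. \<integral>x. ?Z i x * ?Z j x \<partial>M)"
  proof -
    have "(\<integral>x. (\<Sum>i<n. \<Sum>j<n. ?Z i x * ?Z j x) \<partial>M) = (\<Sum>i<n. \<integral>x. (\<Sum>j<n. ?Z i x * ?Z j x) \<partial>M)"
      by (intro Bochner_Integration.integral_sum Bochner_Integration.integrable_sum square_integrable_mult Z(1)) auto
    also have "\<dots> = (\<Sum>i<n. \<Sum>j<n. \<integral>x. ?Z i x * ?Z j x \<partial>M)"
      by (intro sum.cong refl Bochner_Integration.integral_sum square_integrable_mult Z(1)) auto
    finally show ?thesis .
  qed
  also have "\<dots> = (\<Sum>i<n. \<Sum>j<n. if j = i then \<integral>x. ?Z i x * ?Z i x \<partial>M else 0)"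
    by (intro sum.cong refl) (auto simp: orth')
  also have "\<dots> = (\<Sum>i<n. \<integral>x. (?Z i x)\<^sup>2 \<partial>M)"
    by (simp add: power2_eq_square)
  also have "\<dots> = (\<Sum>i<n. (\<integral>x. (\<xi> i x)\<^sup>2 \<partial>M) * (p (Suc i) - p i))"
    by (intro sum.cong refl Z) auto
  finally show "(\<integral>x. (simple_integral B n p \<xi> x)\<^sup>2 \<partial>M) = (\<Sum>i<n. (\<integral>x. (\<xi> i x)\<^sup>2 \<partial>M) * (p (Suc i) - p i))" .
  have "(\<integral>x. ?Z i x * exp (\<theta> * B T x) \<partial>M) = \<theta> * (p (Suc i) - p i) * (\<integral>x. \<xi> i x * exp (\<theta> * B T x) \<partial>M)"
    and "integrable M (\<lambda>x. ?Z i x * exp (\<theta> * B T x))" if "i < n" for i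
  proof -
    show "(\<integral>x. ?Z i x * exp (\<theta> * B T x) \<partial>M) = \<theta> * (p (Suc i) - p i) * (\<integral>x. \<xi> i x * exp (\<theta> * B T x) \<partial>M)"
      using that by (intro integral_increment_mult_exp_B si')
    have "0 \<le> T" using si'(3-5)[OF that] by simp
    then show "integrable M (\<lambda>x. ?Z i x * exp (\<theta> * B T x))"
      using that by (intro square_integrable_mult Z square_integrable_exp_B)
  qed
  then show "(\<integral>x. simple_integral B n p \<xi> x * exp (\<theta> * B T x) \<partial>M)
      = \<theta> * (\<Sum>i<n. (\<integral>x. \<xi> i x * exp (\<theta> * B T x) \<partial>M) * (p (Suc i) - p i))"
    by (simp add: simple_integral_def sum_distrib_right sum_distrib_left Bochner_Integration.integral_sum ac_simps)
qed

text \<open>The intervals \<open>{p i<..p (Suc i)}\<close> are disjoint, so products of different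
  terms vanish pointwise; a single term is a function of time times a function on \<open>M\<close>,
  and its integral factors.\<close>

lemma simple_value_moments:
  assumes si: "simple_integrand M \<F> T n p \<xi>" and T: "0 \<le> T"
  shows "square_integrable (time_paths T) (\<lambda>(s, x). simple_value n p \<xi> s x)"
    and "(\<integral>(s, x). (simple_value n p \<xi> s x)\<^sup>2 \<partial>time_paths T) = (\<Sum>i<n. (\<integral>x. (\<xi> i x)\<^sup>2 \<partial>M) * (p (Suc i) - p i))"
    and "(\<integral>(s, x). simple_value n p \<xi> s x * exp (\<theta> * B T x) \<partial>time_paths T)
           = (\<Sum>i<n. (\<integral>x. \<xi> i x * exp (\<theta> * B T x) \<partial>M) * (p (Suc i) - p i))"
proof -
  note si' = simple_integrand_measurable[OF si]
  let ?I = "\<lambda>i. indicator {p i<..p (Suc i)} :: real \<Rightarrow> real"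
  have prod: "has_bochner_integral (time_paths T) (\<lambda>(s, x). ?I i s * g x) ((p (Suc i) - p i) * (\<integral>x. g x \<partial>M))"
    if "i < n" "integrable M g" for i g
    using pair_sigma_finite.has_bochner_integral_product[OF pair_sigma_finite_time_paths[of T] _ that(2), where f = "?I i"]
      has_bochner_integral_indicator_time_interval[OF si'(3-5)[OF that(1)]] by (simp add: has_bochner_integral_iff)
  let ?Z = "\<lambda>i z. ?I i (fst z) * \<xi> i (snd z)"
  have val: "simple_value n p \<xi> s x = (\<Sum>i<n. ?Z i (s, x))" for s x
    by (simp add: simple_value_def mult.commute)
  have sq: "(?Z i z)\<^sup>2 = ?I i (fst z) * (\<xi> i (snd z))\<^sup>2" for i z
    by (auto simp: power_mult_distrib split: split_indicator)
  have Zb: "has_bochner_integral (time_paths T) (\<lambda>z. (?Z i z)\<^sup>2) ((p (Suc i) - p i) * (\<integral>x. (\<xi> i x)\<^sup>2 \<partial>M))" if "i < n" for i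
    using prod[OF that, of "\<lambda>x. (\<xi> i x)\<^sup>2"] si'(2)[OF that]
    by (simp add: sq square_integrable_def case_prod_unfold)
  have Z: "square_integrable (time_paths T) (?Z i)" if "i < n" for i
  proof -
    have "(\<lambda>z. \<xi> i (snd z)) \<in> borel_measurable (time_paths T)"
      using si'(2)[OF that] by (intro measurable_compose[OF measurable_snd] square_integrable_measurable)
    moreover have "(\<lambda>z. ?I i (fst z)) \<in> borel_measurable (time_paths T)"
      by (rule measurable_compose[OF measurable_fst]) (simp add: measurable_restrict_space1)
    ultimately have "?Z i \<in> borel_measurable (time_paths T)"
      by (intro borel_measurable_times)
    then show ?thesis
      using Zb[OF that] by (simp add: square_integrable_def has_bochner_integral_iff)
  qed
  show S: "square_integrable (time_paths T) (\<lambda>(s, x). simple_value n p \<xi> s x)"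
    unfolding val case_prod_unfold fst_conv snd_conv by (intro square_integrable_sum Z) auto
  have orth: "?Z i z * ?Z j z = 0" if "i < j" "j < n" for i j z
    using simple_integrand_increasing[OF si, of "Suc i" j] that by (auto simp: indicator_def)
  have orth': "?Z i z * ?Z j z = 0" if "i \<noteq> j" "i < n" "j < n" for i j z
    using that orth[of i j] orth[of j i] by (cases "i < j") (auto simp: mult.commute)
  have "(\<integral>(s, x). (simple_value n p \<xi> s x)\<^sup>2 \<partial>time_paths T) = (\<integral>z. (\<Sum>i<n. (?Z i z)\<^sup>2) \<partial>time_paths T)"
  proof (rule Bochner_Integration.integral_cong[OF refl])
    fix z
    have "(\<Sum>i<n. ?Z i z)\<^sup>2 = (\<Sum>i<n. \<Sum>j<n. ?Z i z * ?Z j z)"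
      by (simp only: power2_eq_square sum_product)
    also have "\<dots> = (\<Sum>i<n. \<Sum>j<n. if j = i then ?Z i z * ?Z i z else 0)"
      by (intro sum.cong refl) (metis orth' lessThan_iff)
    also have "\<dots> = (\<Sum>i<n. (?Z i z)\<^sup>2)"
      by (simp add: power2_eq_square)
    finally show "(case z of (s, x) \<Rightarrow> (simple_value n p \<xi> s x)\<^sup>2) = (\<Sum>i<n. (?Z i z)\<^sup>2)"
      by (simp add: val case_prod_unfold)
  qed
  also have "\<dots> = (\<Sum>i<n. (p (Suc i) - p i) * (\<integral>x. (\<xi> i x)\<^sup>2 \<partial>M))"
    using Zb by (subst Bochner_Integration.integral_sum) (auto simp: has_bochner_integral_iff)
  finally show "(\<integral>(s, x). (simple_value n p \<xi> s x)\<^sup>2 \<partial>time_paths T)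
      = (\<Sum>i<n. (\<integral>x. (\<xi> i x)\<^sup>2 \<partial>M) * (p (Suc i) - p i))"
    by (simp add: mult.commute)
  have "(\<integral>(s, x). simple_value n p \<xi> s x * exp (\<theta> * B T x) \<partial>time_paths T)
      = (\<integral>z. (\<Sum>i<n. case z of (s, x) \<Rightarrow> ?I i s * (\<xi> i x * exp (\<theta> * B T x))) \<partial>time_paths T)"
    by (rule Bochner_Integration.integral_cong[OF refl]) (auto simp: val sum_distrib_right mult.assoc)
  also have "\<dots> = (\<Sum>i<n. (p (Suc i) - p i) * (\<integral>x. \<xi> i x * exp (\<theta> * B T x) \<partial>M))"
  proof -
    have "has_bochner_integral (time_paths T) (\<lambda>(s, x). ?I i s * (\<xi> i x * exp (\<theta> * B T x)))
        ((p (Suc i) - p i) * (\<integral>x. \<xi> i x * exp (\<theta> * B T x) \<partial>M))" if "i < n" for i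
      using that T by (intro prod square_integrable_mult square_integrable_exp_B si')
    then show ?thesis
      by (subst Bochner_Integration.integral_sum) (auto simp: has_bochner_integral_iff)
  qed
  finally show "(\<integral>(s, x). simple_value n p \<xi> s x * exp (\<theta> * B T x) \<partial>time_paths T)
      = (\<Sum>i<n. (\<integral>x. \<xi> i x * exp (\<theta> * B T x) \<partial>M) * (p (Suc i) - p i))"
    by (simp add: mult.commute)
qed

lemma square_integrable_exp_B_time_paths:
  assumes "0 \<le> T"
  shows "square_integrable (time_paths T) (\<lambda>(s, x). exp (\<theta> * B T x))"
proof -
  interpret N: finite_measure "time_interval T" by (rule finite_measure_time_interval)
  note sq = square_integrable_exp_B[OF assms, of \<theta>]
  have [measurable]: "B T \<in> borel_measurable M" using measurable_B_M[OF assms] .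
  have "has_bochner_integral (time_paths T) (\<lambda>(s, x). 1 * (exp (\<theta> * B T x))\<^sup>2)
      ((\<integral>s. 1 \<partial>time_interval T) * (\<integral>x. (exp (\<theta> * B T x))\<^sup>2 \<partial>M))"
    using sq by (intro pair_sigma_finite.has_bochner_integral_product[OF pair_sigma_finite_time_paths])
      (auto simp: square_integrable_def)
  then show ?thesis
    by (simp add: square_integrable_def has_bochner_integral_iff case_prod_unfold)
qed

text \<open>
  The last equation, the pairing of an Ito integral with an exponential of \<open>B\<close>, takes the place of
  Ito's formula below.
\<close>

lemma ito_integral_moments:
  assumes ito: "has_ito_integral M \<F> B X T I" and T: "0 \<le> T"
  shows "square_integrable M I"
    and "square_integrable (time_paths T) (\<lambda>(s, x). X s x)"
    and "(\<integral>x. (I x)\<^sup>2 \<partial>M) = (\<integral>(s, x). (X s x)\<^sup>2 \<partial>time_paths T)"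
    and "(\<integral>x. I x * exp (\<theta> * B T x) \<partial>M) = \<theta> * (\<integral>(s, x). X s x * exp (\<theta> * B T x) \<partial>time_paths T)"
proof -
  interpret P: pair_sigma_finite "time_interval T" M by (rule pair_sigma_finite_time_paths)
  obtain n p \<xi> where X: "progressive \<F> X" and Im: "I \<in> borel_measurable M"
    and si: "\<And>m. simple_integrand M \<F> T (n m) (p m) (\<xi> m)"
    and limX: "(\<lambda>m. \<integral>\<^sup>+x. (\<integral>\<^sup>+s. ennreal ((X s x - simple_value (n m) (p m) (\<xi> m) s x)\<^sup>2) * indicator {0..T} s
               \<partial>lborel) \<partial>M) \<longlonglongrightarrow> 0"
    and limI: "(\<lambda>m. \<integral>\<^sup>+x. ennreal ((simple_integral B (n m) (p m) (\<xi> m) x - I x)\<^sup>2) \<partial>M) \<longlonglongrightarrow> 0"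
    using ito unfolding has_ito_integral_def by blast
  let ?X = "\<lambda>(s, x). X s x" and ?V = "\<lambda>m (s, x). simple_value (n m) (p m) (\<xi> m) s x"
    and ?E = "\<lambda>(s, x). exp (\<theta> * B T x)"
  have Xm: "?X \<in> borel_measurable (time_paths T)"
    using measurable_progressive(1)[OF X T] .
  note V = simple_value_moments[OF si T] and S = simple_integral_moments[OF si]
  have Vm: "?V m \<in> borel_measurable (time_paths T)" for m
    using V(1) by (rule square_integrable_measurable)
  \<comment> \<open>Tonelli's theorem turns the iterated integral of the definition into a distance
    on \<open>time_paths T\<close>.\<close>
  have "(\<integral>\<^sup>+x. (\<integral>\<^sup>+s. ennreal ((X s x - simple_value (n m) (p m) (\<xi> m) s x)\<^sup>2) * indicator {0..T} s \<partial>lborel) \<partial>M)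
      = (\<integral>\<^sup>+z. ennreal ((?V m z - ?X z)\<^sup>2) \<partial>time_paths T)" for m
  proof -
    have "(\<lambda>z. ennreal ((?V m z - ?X z)\<^sup>2)) \<in> borel_measurable (time_paths T)"
      using Vm Xm by measurable
    from P.nn_integral_snd[OF this] show ?thesis
      by (simp add: nn_integral_restrict_space power2_commute)
  qed
  with limX have limX': "(\<lambda>m. \<integral>\<^sup>+z. ennreal ((?V m z - ?X z)\<^sup>2) \<partial>time_paths T) \<longlonglongrightarrow> 0"
    by simp
  note LX = square_integrable_limit[OF V(1) Xm limX']
  note LI = square_integrable_limit[OF S(1) Im limI]
  show "square_integrable M I" by (rule LI(1))
  show "square_integrable (time_paths T) ?X" by (rule LX(1))
  \<comment> \<open>For each \<open>m\<close> the integral and the integrand have the same second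
    moment, so this sequence also converges to the second moment of \<open>X\<close>.\<close>
  have "(\<lambda>m. \<integral>x. (simple_integral B (n m) (p m) (\<xi> m) x)\<^sup>2 \<partial>M) \<longlonglongrightarrow> (\<integral>z. (?X z)\<^sup>2 \<partial>time_paths T)"
    using LX(3) V(2) unfolding S(2) by (simp add: case_prod_unfold)
  then show "(\<integral>x. (I x)\<^sup>2 \<partial>M) = (\<integral>(s, x). (X s x)\<^sup>2 \<partial>time_paths T)"
    using LIMSEQ_unique[OF LI(3)] by (simp add: case_prod_unfold)
  have "(\<lambda>m. \<theta> * (\<integral>z. ?V m z * ?E z \<partial>time_paths T)) \<longlonglongrightarrow> \<theta> * (\<integral>z. ?X z * ?E z \<partial>time_paths T)"
    by (intro tendsto_intros LX(2) square_integrable_exp_B_time_paths T)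
  then have "(\<lambda>m. \<integral>x. simple_integral B (n m) (p m) (\<xi> m) x * exp (\<theta> * B T x) \<partial>M)
      \<longlonglongrightarrow> \<theta> * (\<integral>z. ?X z * ?E z \<partial>time_paths T)"
    using V(3) unfolding S(3) by (simp add: case_prod_unfold)
  then show "(\<integral>x. I x * exp (\<theta> * B T x) \<partial>M) = \<theta> * (\<integral>(s, x). X s x * exp (\<theta> * B T x) \<partial>time_paths T)"
    using LIMSEQ_unique[OF LI(2)[OF square_integrable_exp_B[OF T]]] by (simp add: case_prod_unfold)
qed

section \<open>The linear stochastic equation\<close>

lemma Fubini_time_paths:
  fixes h :: "real \<Rightarrow> 's \<Rightarrow> real"
  assumes "integrable (time_paths T) (\<lambda>(s, x). h s x)"
  shows "set_integrable lborel {0..T} (\<lambda>s. \<integral>x. h s x \<partial>M)"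
    and "(\<integral>(s, x). h s x \<partial>time_paths T) = (LBINT s:{0..T}. \<integral>x. h s x \<partial>M)"
proof -
  interpret P: pair_sigma_finite "time_interval T" M by (rule pair_sigma_finite_time_paths)
  have Icc: "{0..T} \<inter> space lborel \<in> sets lborel" by simp
  show "set_integrable lborel {0..T} (\<lambda>s. \<integral>x. h s x \<partial>M)"
    using P.integrable_fst'[OF assms] by (simp add: integrable_restrict_space[OF Icc] set_integrable_def)
  show "(\<integral>(s, x). h s x \<partial>time_paths T) = (LBINT s:{0..T}. \<integral>x. h s x \<partial>M)"
    using P.integral_fst'[OF assms] by (simp add: integral_restrict_space[OF Icc] set_lebesgue_integral_def)
qed

text \<open>
  Let \<open>Z t = exp (s * B t - s\<^sup>2 * t / 2)\<close>. Both \<open>u t = E (W t)\<^sup>2\<close> and \<open>y t = E (W t * Z t)\<close> solve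
  the integral equation of an exponential with rate \<open>s\<^sup>2\<close>, and so \<open>E (W t - w0 * Z t)\<^sup>2 = 0\<close>.
\<close>

lemma linear_sde_solution:
  assumes W: "progressive \<F> W" and s: "s \<noteq> 0"
    and ito: "\<And>t. 0 \<le> t \<Longrightarrow> has_ito_integral M \<F> B X t (I t)"
    and X: "\<And>t. 0 \<le> t \<Longrightarrow> AE x in M. X t x = s * W t x"
    and I: "\<And>t. 0 \<le> t \<Longrightarrow> AE x in M. W t x = w0 + I t x"
    and T: "0 \<le> T"
  shows "AE x in M. W T x = w0 * exp (s * B T x - s\<^sup>2 * T / 2)"
proof -
  have Wm: "W t \<in> borel_measurable (\<F> t)" "W t \<in> borel_measurable M" if "0 \<le> t" for t
    using measurable_progressive(2)[OF W that] measurable_filtration by blast+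
  have Isq: "square_integrable M (I t)" if "0 \<le> t" for t
    using ito_integral_moments(1)[OF ito] that by simp
  have Wsq: "square_integrable M (W t)" if "0 \<le> t" for t
  proof (rule square_integrable_cong_AE)
    show "square_integrable M (\<lambda>x. w0 + I t x)"
      by (intro square_integrable_add square_integrable_const Isq that)
    show "AE x in M. w0 + I t x = W t x"
      using I[OF that] by eventually_elim simp
  qed (rule Wm[OF that])
  \<comment> \<open>The exceptional set may depend on the date; joint measurability still makes the
    relation hold almost everywhere on the product.\<close>
  have W_X: "AE z in time_paths t. (case z of (s, x) \<Rightarrow> X s x) = s * (case z of (s, x) \<Rightarrow> W s x)" if "0 \<le> t" for t
  proof -
    interpret P: pair_sigma_finite "time_interval t" M by (rule pair_sigma_finite_time_paths)
    have [measurable]: "(\<lambda>(s, x). X s x) \<in> borel_measurable (time_paths t)"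
      "(\<lambda>(s, x). W s x) \<in> borel_measurable (time_paths t)"
      using ito[OF that] W that by (auto intro!: measurable_progressive simp: has_ito_integral_def)
    show ?thesis
    proof (rule P.AE_pair_measure)
      show "AE u in time_interval t. AE x in M. (case (u, x) of (s, x) \<Rightarrow> X s x) = s * (case (u, x) of (s, x) \<Rightarrow> W s x)"
        by (rule AE_I2) (use X in \<open>simp add: space_restrict_space\<close>)
    qed measurable
  qed
  \<comment> \<open>Only \<open>X\<close> is known to be square integrable in time and state;
    \<open>W\<close> inherits this on division by \<open>s\<close>.\<close>
  have Wsq': "square_integrable (time_paths t) (\<lambda>(s, x). W s x)" if "0 \<le> t" for t
  proof (rule square_integrable_cong_AE)
    show "square_integrable (time_paths t) (\<lambda>z. (1 / s) * (case z of (s, x) \<Rightarrow> X s x))"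
      by (intro square_integrable_cmult ito_integral_moments(2)[OF ito] that)
    show "AE z in time_paths t. (1 / s) * (case z of (s, x) \<Rightarrow> X s x) = (case z of (s, x) \<Rightarrow> W s x)"
      using W_X[OF that] by eventually_elim (use s in simp)
  qed (rule measurable_progressive[OF W that])
  \<comment> \<open>The pairing with weight exponent zero says that Ito integrals have mean
    zero.\<close>
  have I_0: "(\<integral>x. I t x \<partial>M) = 0" if "0 \<le> t" for t
    using ito_integral_moments(4)[OF ito[OF that] that, of 0] by simp

  define u where "u t = (\<integral>x. (W t x)\<^sup>2 \<partial>M)" for t
  have u_sq: "integrable (time_paths t) (\<lambda>(s, x). (W s x)\<^sup>2)" if "0 \<le> t" for t
    using Wsq'[OF that] by (simp add: square_integrable_def case_prod_unfold)
  \<comment> \<open>The cross term has mean zero, and the isometry turns the square of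
    \<open>I t\<close> into a time integral of \<open>u\<close>.\<close>
  have u_eq: "u t = w0\<^sup>2 + s\<^sup>2 * (LBINT r:{0..t}. u r)" if t: "0 \<le> t" for t
  proof -
    have "u t = (\<integral>x. (w0 + I t x)\<^sup>2 \<partial>M)"
      unfolding u_def using I[OF t] Wm(2)[OF t] square_integrable_measurable[OF Isq[OF t]]
      by (intro integral_cong_AE) auto
    also have "\<dots> = (\<integral>x. w0\<^sup>2 + 2 * w0 * I t x + (I t x)\<^sup>2 \<partial>M)"
      by (simp add: power2_sum algebra_simps)
    also have "\<dots> = w0\<^sup>2 + (\<integral>x. (I t x)\<^sup>2 \<partial>M)"
      using square_integrable_imp_integrable[OF Isq[OF t]] Isq[OF t] I_0[OF t] prob_space
      by (simp add: square_integrable_def)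
    also have "(\<integral>x. (I t x)\<^sup>2 \<partial>M) = (\<integral>(s, x). (X s x)\<^sup>2 \<partial>time_paths t)"
      by (rule ito_integral_moments(3)[OF ito[OF t] t])
    also have "\<dots> = (\<integral>z. s\<^sup>2 * (case z of (s, x) \<Rightarrow> (W s x)\<^sup>2) \<partial>time_paths t)"
    proof (rule integral_cong_AE)
      show "AE z in time_paths t. (case z of (s, x) \<Rightarrow> (X s x)\<^sup>2) = s\<^sup>2 * (case z of (s, x) \<Rightarrow> (W s x)\<^sup>2)"
        using W_X[OF t] by eventually_elim (auto simp: case_prod_unfold power_mult_distrib)
      show "(\<lambda>z. s\<^sup>2 * (case z of (s, x) \<Rightarrow> (W s x)\<^sup>2)) \<in> borel_measurable (time_paths t)"
        using u_sq[OF t] by (intro borel_measurable_times) auto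
      show "(\<lambda>(s, x). (X s x)\<^sup>2) \<in> borel_measurable (time_paths t)"
        using ito_integral_moments(2)[OF ito[OF t] t]
        by (auto simp: square_integrable_def case_prod_unfold dest: borel_measurable_integrable)
    qed
    also have "\<dots> = s\<^sup>2 * (LBINT r:{0..t}. u r)"
      using Fubini_time_paths(2)[OF u_sq[OF t]] by (simp add: u_def)
    finally show ?thesis .
  qed
  have u: "u T = w0\<^sup>2 * exp (s\<^sup>2 * T)"
    using T Fubini_time_paths(1)[OF u_sq[OF T]] u_eq
    by (intro linear_integral_equation) (auto simp: u_def)

  \<comment> \<open>The last factor is the deterministic part of the candidate
    \<open>Z t\<close>.\<close>
  define y where "y t = (\<integral>x. W t x * exp (s * B t x) \<partial>M) * exp (- (s\<^sup>2 * t / 2))" for t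
  \<comment> \<open>The pairing formula tests the integrand at every \<open>r\<close> against the
    exponential at the final date \<open>t\<close>. The normalization in \<open>y\<close> makes the
    dependence on \<open>t\<close> a common factor, so that the equation for \<open>y\<close>
    closes.\<close>
  have W_exp: "(\<integral>x. W r x * exp (s * B t x) \<partial>M) = y r * exp (s\<^sup>2 * t / 2)" if "0 \<le> r" "r \<le> t" for r t
  proof -
    have "integrable M (\<lambda>x. W r x * exp (s * B r x))"
      using that by (intro square_integrable_mult square_integrable_exp_B Wsq) auto
    from integral_mult_exp[OF that Wm(1)[OF that(1)] this]
    have "(\<integral>x. W r x * exp (s * B t x) \<partial>M)
        = (\<integral>x. W r x * exp (s * B r x) \<partial>M) * exp (s\<^sup>2 * (t - r) / 2)"
      by (simp add: has_bochner_integral_iff)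
    also have "exp (s\<^sup>2 * (t - r) / 2) = exp (- (s\<^sup>2 * r / 2)) * exp (s\<^sup>2 * t / 2)"
      by (simp add: right_diff_distrib diff_divide_distrib flip: exp_add)
    finally show ?thesis by (simp add: y_def mult.assoc)
  qed
  have y_int: "integrable (time_paths t) (\<lambda>(r, x). W r x * exp (s * B t x))" if "0 \<le> t" for t
    using square_integrable_mult[OF Wsq'[OF that] square_integrable_exp_B_time_paths[OF that, of s]]
    by (simp add: case_prod_unfold)
  have y_set_int: "set_integrable lborel {0..t} y" if t: "0 \<le> t" for t
  proof -
    have "set_integrable lborel {0..t} (\<lambda>r. y r * exp (s\<^sup>2 * t / 2))"
      using Fubini_time_paths(1)[OF y_int[OF t]]
      by (rule set_integrable_cong[THEN iffD1, rotated -1]) (auto simp: W_exp)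
    then show ?thesis by simp
  qed
  have y_eq: "y t = w0 + s\<^sup>2 * (LBINT r:{0..t}. y r)" if t: "0 \<le> t" for t
  proof -
    have "y t * exp (s\<^sup>2 * t / 2) = (\<integral>x. W t x * exp (s * B t x) \<partial>M)"
      using W_exp[of t t] t by simp
    also have "\<dots> = (\<integral>x. w0 * exp (s * B t x) + I t x * exp (s * B t x) \<partial>M)"
    proof (rule integral_cong_AE)
      show "AE x in M. W t x * exp (s * B t x) = w0 * exp (s * B t x) + I t x * exp (s * B t x)"
        using I[OF t] by eventually_elim (simp add: distrib_right)
    qed (use Wm(2)[OF t] square_integrable_measurable[OF Isq[OF t]] measurable_B_M[OF t] in auto)
    also have "\<dots> = w0 * (\<integral>x. exp (s * B t x) \<partial>M) + (\<integral>x. I t x * exp (s * B t x) \<partial>M)"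
      using square_integrable_mult[OF Isq[OF t] square_integrable_exp_B[OF t, of s]]
        square_integrable_imp_integrable[OF square_integrable_exp_B[OF t, of s]] by simp
    also have "(\<integral>x. exp (s * B t x) \<partial>M) = exp (s\<^sup>2 * t / 2)"
      using has_bochner_integral_exp_B[OF t, of s] by (simp add: has_bochner_integral_iff)
    also have "(\<integral>x. I t x * exp (s * B t x) \<partial>M) = s * (\<integral>(r, x). X r x * exp (s * B t x) \<partial>time_paths t)"
      by (rule ito_integral_moments(4)[OF ito[OF t] t])
    also have "(\<integral>(r, x). X r x * exp (s * B t x) \<partial>time_paths t)
        = (\<integral>z. s * (case z of (r, x) \<Rightarrow> W r x * exp (s * B t x)) \<partial>time_paths t)"
    proof (rule integral_cong_AE)
      show "AE z in time_paths t. (case z of (r, x) \<Rightarrow> X r x * exp (s * B t x))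
          = s * (case z of (r, x) \<Rightarrow> W r x * exp (s * B t x))"
        using W_X[OF t] by eventually_elim (auto simp: case_prod_unfold)
      show "(\<lambda>z. s * (case z of (r, x) \<Rightarrow> W r x * exp (s * B t x))) \<in> borel_measurable (time_paths t)"
        using y_int[OF t] by (intro borel_measurable_times) auto
      show "(\<lambda>(r, x). X r x * exp (s * B t x)) \<in> borel_measurable (time_paths t)"
        using square_integrable_mult[OF ito_integral_moments(2)[OF ito[OF t] t]
            square_integrable_exp_B_time_paths[OF t, of s]] by (simp add: case_prod_unfold)
    qed
    also have "\<dots> = s * (LBINT r:{0..t}. \<integral>x. W r x * exp (s * B t x) \<partial>M)"
      using Fubini_time_paths(2)[OF y_int[OF t]] by simp
    also have "(LBINT r:{0..t}. \<integral>x. W r x * exp (s * B t x) \<partial>M) = (LBINT r:{0..t}. y r * exp (s\<^sup>2 * t / 2))"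
      by (rule set_lebesgue_integral_cong) (auto simp: W_exp)
    also have "\<dots> = (LBINT r:{0..t}. y r) * exp (s\<^sup>2 * t / 2)"
      by simp
    finally have "y t * exp (s\<^sup>2 * t / 2) = (w0 + s\<^sup>2 * (LBINT r:{0..t}. y r)) * exp (s\<^sup>2 * t / 2)"
      by (simp add: algebra_simps power2_eq_square)
    then show ?thesis by simp
  qed
  have y: "y T = w0 * exp (s\<^sup>2 * T)"
    using T y_set_int[OF T] y_eq by (intro linear_integral_equation) auto

  define Z where "Z x = exp (- (s\<^sup>2 * T / 2)) * exp (s * B T x)" for x
  have Zsq: "square_integrable M Z"
    unfolding Z_def[abs_def] by (intro square_integrable_cmult square_integrable_exp_B T)
  have Z2: "(\<integral>x. (Z x)\<^sup>2 \<partial>M) = exp (s\<^sup>2 * T)"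
  proof -
    have "(Z x)\<^sup>2 = exp (- (s\<^sup>2 * T)) * exp ((2 * s) * B T x)" for x
      by (simp add: Z_def power2_eq_square flip: exp_add)
    then have "(\<integral>x. (Z x)\<^sup>2 \<partial>M) = exp (- (s\<^sup>2 * T)) * exp ((2 * s)\<^sup>2 * T / 2)"
      using has_bochner_integral_exp_B[OF T, of "2 * s"] by (simp add: has_bochner_integral_iff)
    also have "\<dots> = exp (s\<^sup>2 * T)"
      by (simp add: power_mult_distrib flip: exp_add)
    finally show ?thesis .
  qed
  have WZ: "(\<integral>x. W T x * Z x \<partial>M) = w0 * exp (s\<^sup>2 * T)"
  proof -
    have "W T x * Z x = (W T x * exp (s * B T x)) * exp (- (s\<^sup>2 * T / 2))" for x
      by (simp add: Z_def ac_simps)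
    then have "(\<integral>x. W T x * Z x \<partial>M) = y T"
      by (simp only: y_def integral_mult_left_zero)
    then show ?thesis using y by simp
  qed
  have dsq: "square_integrable M (\<lambda>x. W T x - w0 * Z x)"
    by (intro square_integrable_diff square_integrable_cmult Wsq T Zsq)
  have "(\<integral>x. (W T x - w0 * Z x)\<^sup>2 \<partial>M) = (\<integral>x. (W T x)\<^sup>2 - 2 * w0 * (W T x * Z x) + w0\<^sup>2 * (Z x)\<^sup>2 \<partial>M)"
    by (simp add: power2_eq_square algebra_simps)
  also have "\<dots> = u T - 2 * w0 * (\<integral>x. W T x * Z x \<partial>M) + w0\<^sup>2 * (\<integral>x. (Z x)\<^sup>2 \<partial>M)"
    using Wsq[OF T] Zsq square_integrable_mult[OF Wsq[OF T] Zsq] by (simp add: square_integrable_def u_def)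
  \<comment> \<open>The three terms are \<open>1\<close>, \<open>- 2\<close> and \<open>1\<close>
    times \<open>w0\<^sup>2 * exp (s\<^sup>2 * T)\<close>.\<close>
  also have "\<dots> = 0"
    unfolding u WZ Z2 by (simp add: power2_eq_square)
  finally have "AE x in M. (W T x - w0 * Z x)\<^sup>2 = 0"
    using dsq by (subst (asm) integral_nonneg_eq_0_iff_AE) (auto simp: square_integrable_def)
  then show ?thesis
  proof eventually_elim
    case (elim x)
    have "Z x = exp (s * B T x - s\<^sup>2 * T / 2)"
      by (simp add: Z_def flip: exp_add)
    with elim show ?case by simp
  qed
qed

end

subsection \<open>The value function\<close>

lemma set_integral_exp:
  fixes k :: real
  assumes "k \<noteq> 0"
  shows "(LBINT s:{0..1}. exp (k * s)) = (exp k - 1) / k"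
proof -
  have "((\<lambda>s. exp (k * s)) has_integral exp (k * 1) / k - exp (k * 0) / k) {0..1}"
  proof (rule fundamental_theorem_of_calculus)
    fix s :: real
    have "((\<lambda>s. exp (k * s) / k) has_real_derivative exp (k * s)) (at s within {0..1})"
      using assms by (auto intro!: derivative_eq_intros)
    then show "((\<lambda>s. exp (k * s) / k) has_vector_derivative exp (k * s)) (at s within {0..1})"
      by (simp add: has_real_derivative_iff_has_vector_derivative)
  qed simp
  moreover have "set_integrable lborel {0..1} (\<lambda>s. exp (k * s))"
    unfolding set_integrable_def by (intro borel_integrable_compact continuous_intros) auto
  ultimately show ?thesis
    by (simp add: set_borel_integral_eq_integral integral_unique diff_divide_distrib)
qed

context brownian
begin

text \<open>Taking expectations of the recursion at date zero removes the conditional expectation,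
  and integrability on the product allows the exchange of time integral and expectation.\<close>

lemma recursive_utility_expectation:
  assumes ru: "recursive_utility E M \<F> c U" and T: "0 \<le> T"
  shows "(\<integral>x. U 0 x \<partial>M)
    = (LBINT s:{0..T}. \<integral>x. aggregator E (c s x) (U s x) \<partial>M) + (\<integral>x. U T x \<partial>M)"
proof -
  let ?h = "\<lambda>s x. indicator {0..T} s * aggregator E (c s x) (U s x)"
  interpret L: pair_sigma_finite lborel M ..
  interpret G: finite_measure_subalgebra M "\<F> 0"
    by unfold_locales (rule subalgebra_filtration)
  have UT: "integrable M (U T)" "integrable M (U 0)"
    and "set_integrable (lborel \<Otimes>\<^sub>M M) ({0..T} \<times> space M) (\<lambda>(s, x). aggregator E (c s x) (U s x))"
    and rec: "AE x in M. U 0 x = real_cond_exp M (\<F> 0) (accrued_utility E c U 0 T) x"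
    using ru T by (auto simp: recursive_utility_def utility_integrable_def)
  then have "integrable (lborel \<Otimes>\<^sub>M M)
      (\<lambda>z. indicator ({0..T} \<times> space M) z *\<^sub>R (case z of (s, x) \<Rightarrow> aggregator E (c s x) (U s x)))"
    by (simp add: set_integrable_def)
  then have int: "integrable (lborel \<Otimes>\<^sub>M M) (\<lambda>(s, x). ?h s x)"
    by (rule Bochner_Integration.integrable_cong[THEN iffD1, rotated -1])
      (auto simp: space_pair_measure indicator_def)
  have acc: "accrued_utility E c U 0 T x = (\<integral>s. ?h s x \<partial>lborel) + U T x" for x
    by (simp add: accrued_utility_def set_lebesgue_integral_def)
  have acc_int: "integrable M (accrued_utility E c U 0 T)"
    unfolding acc[abs_def] using L.integrable_snd[OF int] UT by simp
  have "(\<integral>x. U 0 x \<partial>M) = (\<integral>x. real_cond_exp M (\<F> 0) (accrued_utility E c U 0 T) x \<partial>M)"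
    using rec UT G.real_cond_exp_int(1)[OF acc_int] by (intro integral_cong_AE) auto
  also have "\<dots> = (\<integral>x. (\<integral>s. ?h s x \<partial>lborel) + U T x \<partial>M)"
    using G.real_cond_exp_int(2)[OF acc_int] by (simp add: acc)
  also have "\<dots> = (\<integral>x. (\<integral>s. ?h s x \<partial>lborel) \<partial>M) + (\<integral>x. U T x \<partial>M)"
    using L.integrable_snd[OF int] UT by simp
  also have "(\<integral>x. (\<integral>s. ?h s x \<partial>lborel) \<partial>M) = (\<integral>s. (\<integral>x. ?h s x \<partial>M) \<partial>lborel)"
    by (rule L.Fubini_integral[OF int])
  also have "\<dots> = (LBINT s:{0..T}. \<integral>x. aggregator E (c s x) (U s x) \<partial>M)"
    by (simp add: set_lebesgue_integral_def)
  finally show ?thesis .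
qed

text \<open>
  Along the optimal plan the aggregator is a multiple \<open>C * J (W t)\<close> of the utility, and
  \<open>E (J (W t)) = J w0 * exp (k * t)\<close>. The recursion between the dates 0 and 1 forces \<open>C = - k\<close>,
  which determines \<open>a\<close>.
\<close>

lemma value_coefficient:
  fixes E :: economy and a s w0 :: real
  defines "\<beta> \<equiv> disc E" and "\<gamma> \<equiv> rra E"
  defines "J \<equiv> \<lambda>w. 1 / (1 - \<gamma>) * (a * w) powr (1 - \<gamma>)"
  assumes pos: "\<beta> > 0" "\<gamma> > 0" "\<gamma> \<noteq> 1" "a > 0" "w0 > 0" and s: "s \<noteq> 0"
    and W: "\<And>t. 0 \<le> t \<Longrightarrow> AE x in M. W t x = w0 * exp (s * B t x - s\<^sup>2 * t / 2)"
    and Wm: "\<And>t. 0 \<le> t \<Longrightarrow> W t \<in> borel_measurable M" "\<And>t. 0 \<le> t \<Longrightarrow> c t \<in> borel_measurable M"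
    and c: "AE x in M. \<forall>t\<ge>0. W t x > 0 \<and> c t x = \<beta> * W t x"
    and ru: "recursive_utility E M \<F> c (\<lambda>t x. J (W t x))"
  shows "a = \<beta> * exp (- (\<gamma> * s\<^sup>2 / (2 * \<beta>)))"
proof -
  define q where "q = 1 - \<gamma>"
  \<comment> \<open>\<open>J (W t)\<close> carries \<open>exp (q * s * B t)\<close>, whose mean
    grows at rate \<open>q\<^sup>2 * s\<^sup>2 / 2\<close>, and the factor
    \<open>exp (- (q * s\<^sup>2 * t / 2))\<close>.\<close>
  define k where "k = (q\<^sup>2 - q) * s\<^sup>2 / 2"
  \<comment> \<open>In the aggregator the logarithms of consumption and of utility both contain
    \<open>q * ln (W t x)\<close>; it cancels, leaving this constant multiple of utility.\<close>
  define C where "C = \<beta> * q * (ln \<beta> - ln a)"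
  have q: "q \<noteq> 0" "q \<noteq> 1" using pos by (auto simp: q_def)
  \<comment> \<open>Relative risk aversion is neither \<open>1\<close> nor \<open>0\<close>. This
    permits division by \<open>k\<close> and by \<open>exp k - 1\<close>.\<close>
  have k: "k \<noteq> 0"
    using q s by (simp add: k_def power2_eq_square)
  have J: "J w = 1 / q * (a * w) powr q" for w
    by (simp add: J_def q_def)
  have Jm: "(\<lambda>x. J (W t x)) \<in> borel_measurable M" if "0 \<le> t" for t
    unfolding J using Wm(1)[OF that] by measurable
  have EJ: "(\<integral>x. J (W t x) \<partial>M) = J w0 * exp (k * t)" if t: "0 \<le> t" for t
  proof -
    have "(\<integral>x. J (W t x) \<partial>M) = (\<integral>x. J w0 * exp (- (q * s\<^sup>2 * t / 2)) * exp ((q * s) * B t x) \<partial>M)"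
    proof (rule integral_cong_AE)
      show "AE x in M. J (W t x) = J w0 * exp (- (q * s\<^sup>2 * t / 2)) * exp ((q * s) * B t x)"
        using W[OF t]
      proof eventually_elim
        case (elim x)
        have "(a * W t x) powr q = (a * w0) powr q * exp (s * B t x - s\<^sup>2 * t / 2) powr q"
          using pos by (simp add: elim powr_mult flip: mult.assoc)
        also have "exp (s * B t x - s\<^sup>2 * t / 2) powr q = exp (- (q * s\<^sup>2 * t / 2)) * exp ((q * s) * B t x)"
          by (simp add: powr_def algebra_simps flip: exp_add)
        finally show ?case by (simp add: J)
      qed
    qed (use Jm[OF t] measurable_B_M[OF t] in auto)
    also have "\<dots> = J w0 * exp (- (q * s\<^sup>2 * t / 2)) * exp ((q * s)\<^sup>2 * t / 2)"
      using has_bochner_integral_exp_B[OF t, of "q * s"] by (simp add: has_bochner_integral_iff)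
    also have "\<dots> = J w0 * exp (k * t)"
      by (simp add: k_def power_mult_distrib algebra_simps diff_divide_distrib flip: exp_add)
    finally show ?thesis .
  qed
  have h: "(\<integral>x. aggregator E (c t x) (J (W t x)) \<partial>M) = C * (J w0 * exp (k * t))" if t: "0 \<le> t" for t
  proof -
    have "(\<integral>x. aggregator E (c t x) (J (W t x)) \<partial>M) = (\<integral>x. C * J (W t x) \<partial>M)"
    proof (rule integral_cong_AE)
      show "(\<lambda>x. aggregator E (c t x) (J (W t x))) \<in> borel_measurable M"
        unfolding aggregator_def using Jm[OF t] Wm(2)[OF t] by measurable
      show "AE x in M. aggregator E (c t x) (J (W t x)) = C * J (W t x)"
        using c
      proof eventually_elim
        case (elim x)
        then have w: "W t x > 0" and cw: "c t x = \<beta> * W t x" using t by auto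
        have "ln (q * J (W t x)) = q * ln (a * W t x)"
          using q pos w by (simp add: J ln_powr)
        also have "\<dots> = q * (ln a + ln (W t x))"
          using pos w by (simp add: ln_mult)
        finally have "aggregator E (c t x) (J (W t x))
            = \<beta> * J (W t x) * (q * (ln \<beta> + ln (W t x)) - q * (ln a + ln (W t x)))"
          using pos w unfolding aggregator_def cw \<beta>_def[symmetric] \<gamma>_def[symmetric] q_def[symmetric]
          by (simp add: ln_mult)
        also have "\<dots> = C * J (W t x)"
          by (simp add: C_def algebra_simps)
        finally show ?case .
      qed
    qed (use Jm[OF t] in auto)
    then show ?thesis using EJ[OF t] by simp
  qed
  have "J w0 = (LBINT t:{0..1}. C * (J w0 * exp (k * t))) + J w0 * exp k"
  proof -
    have "(LBINT t:{0..1}. \<integral>x. aggregator E (c t x) (J (W t x)) \<partial>M) = (LBINT t:{0..1}. C * (J w0 * exp (k * t)))"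
      by (rule set_lebesgue_integral_cong) (auto simp: h)
    then show ?thesis
      using recursive_utility_expectation[OF ru, of 1] EJ[of 0] EJ[of 1] by simp
  qed
  also have "\<dots> = J w0 * (C * ((exp k - 1) / k) + exp k)"
    using set_integral_exp[OF k] by (simp add: algebra_simps)
  finally have "C * ((exp k - 1) / k) = - (exp k - 1)"
    using pos q by (simp add: J)
  from arg_cong[OF this, of "\<lambda>x. x * k"] have "C * (exp k - 1) = - (exp k - 1) * k"
    using k by simp
  then have "(C + k) * (exp k - 1) = 0"
    by (simp add: algebra_simps)
  then have "C = - k"
    using k by (simp add: add_eq_0_iff)
  \<comment> \<open>Since \<open>1 - q = \<gamma>\<close>, the rate \<open>- k\<close> equals
    \<open>q * \<gamma> * s\<^sup>2 / 2\<close>.\<close>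
  then have "q * (\<beta> * (ln \<beta> - ln a)) = q * (\<gamma> * s\<^sup>2 / 2)"
    by (simp add: C_def k_def q_def power2_eq_square field_simps)
  then have "\<beta> * (ln \<beta> - ln a) = \<gamma> * s\<^sup>2 / 2"
    using q(1) by (simp only: mult_cancel_left) simp
  then have "ln a = ln \<beta> - \<gamma> * s\<^sup>2 / (2 * \<beta>)"
    using pos by (simp add: field_simps)
  then have "a = exp (ln \<beta> - \<gamma> * s\<^sup>2 / (2 * \<beta>))"
    using pos by (metis exp_ln)
  then have "a = exp (ln \<beta>) * exp (- (\<gamma> * s\<^sup>2 / (2 * \<beta>)))"
    by (simp only: diff_conv_add_uminus exp_add)
  then show ?thesis
    using pos by simp
qed

end

subsection \<open>Steady state\<close>

lemma strict_antimono_on_greaterThan_deriv: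
  fixes g :: "real \<Rightarrow> real"
  assumes "\<And>k. k > 0 \<Longrightarrow> g differentiable (at k)" "\<And>k. k > 0 \<Longrightarrow> deriv g k < 0"
  shows "strict_antimono_on {0<..} g"
proof (rule monotone_onI)
  fix a b :: real
  assume "a \<in> {0<..}" "b \<in> {0<..}" "a < b"
  then show "g a > g b"
    using assms DERIV_deriv_iff_real_differentiable
    by (intro DERIV_neg_imp_decreasing[of a b g]) fastforce+
qed

context
  fixes E :: economy and f :: "real \<Rightarrow> real" and \<beta> :: real and ratio :: "real \<Rightarrow> real"
  assumes economy: "economy E"
  defines "f \<equiv> unit_prod E" and "\<beta> \<equiv> disc E"
  defines "ratio \<equiv> \<lambda>\<tau>. the_inv_into {0<..} (deriv f) (\<beta> / (1 - \<tau>))"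
begin

section \<open>The marginal product and its inverse\<close>

lemma f_has_derivative: "k > 0 \<Longrightarrow> (f has_real_derivative deriv f k) (at k)"
  using economy by (simp add: economy_def f_def DERIV_deriv_iff_real_differentiable)

lemma deriv_f_has_derivative: "k > 0 \<Longrightarrow> (deriv f has_real_derivative deriv (deriv f) k) (at k)"
  using economy by (simp add: economy_def f_def DERIV_deriv_iff_real_differentiable)

lemma deriv_f_decreasing: "strict_antimono_on {0<..} (deriv f)"
  using economy by (intro strict_antimono_on_greaterThan_deriv) (simp_all add: economy_def f_def)

lemma inj_on_deriv_f: "inj_on (deriv f) {0<..}"
proof (rule linorder_inj_onI')
  fix a b :: real
  assume "a \<in> {0<..}" "b \<in> {0<..}" "a < b"
  then show "deriv f a \<noteq> deriv f b"
    using monotone_onD[OF deriv_f_decreasing] by fastforce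
qed

text \<open>The way to evaluate the inverse of the marginal product: by injectivity any positive
  root is the value. It is applied to the equilibrium capital-labor ratio and to the Cobb-Douglas
  closed form.\<close>

lemma ratio_eqI: "k > 0 \<Longrightarrow> deriv f k = \<beta> / (1 - \<tau>) \<Longrightarrow> ratio \<tau> = k"
  unfolding ratio_def by (intro the_inv_into_f_eq inj_on_deriv_f) auto

text \<open>The marginal product is unbounded near zero and has a limit at most zero at infinity
  (possibly \<open>- \<infinity>\<close>, hence \<open>ereal\<close>), so it crosses every positive
  level by continuity.\<close>

lemma deriv_f_surj:
  assumes "y > 0"
  obtains k where "k > 0" "deriv f k = y"
proof -
  have "eventually (\<lambda>k. deriv f k \<ge> y) (at_right 0)"
    using economy by (simp add: economy_def f_def filterlim_at_top)
  moreover have "eventually (\<lambda>k::real. k \<in> {0<..<1}) (at_right 0)"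
    by (rule eventually_at_right_real) simp
  ultimately have "eventually (\<lambda>k. deriv f k \<ge> y \<and> k \<in> {0<..<1}) (at_right 0)"
    by (rule eventually_conj)
  then obtain a where a: "deriv f a \<ge> y" "0 < a"
    using eventually_happens' trivial_limit_at_right_real by (metis (no_types, lifting) greaterThanLessThan_iff)
  obtain m :: ereal where m: "m \<le> 0" "((\<lambda>k. ereal (deriv f k)) \<longlongrightarrow> m) at_top"
    using economy by (auto simp: economy_def f_def)
  have "m < ereal y"
    using m(1) assms by (metis ereal_less(2) le_less_trans)
  with m(2) have "eventually (\<lambda>k. ereal (deriv f k) < ereal y) at_top"
    by (rule order_tendstoD)
  moreover have "eventually (\<lambda>k. k \<ge> a) at_top"
    by (rule eventually_ge_at_top)
  ultimately have "eventually (\<lambda>k. ereal (deriv f k) < ereal y \<and> k \<ge> a) at_top"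
    by (rule eventually_conj)
  then obtain b where b: "deriv f b < y" "b \<ge> a"
    using eventually_happens' trivial_limit_at_top_linorder by fastforce
  have "\<exists>k. a \<le> k \<and> k \<le> b \<and> deriv f k = y"
  proof (rule IVT2)
    show "\<forall>x. a \<le> x \<and> x \<le> b \<longrightarrow> isCont (deriv f) x"
      using a(2) by (auto intro!: DERIV_isCont deriv_f_has_derivative)
  qed (use a b in auto)
  then obtain k where "a \<le> k" "deriv f k = y" by blast
  with a(2) that[of k] show ?thesis by simp
qed

lemma
  assumes "\<tau> < 1"
  shows ratio_pos: "ratio \<tau> > 0" and deriv_f_ratio: "deriv f (ratio \<tau>) = \<beta> / (1 - \<tau>)"
proof -
  have "\<beta> / (1 - \<tau>) > 0"
    using economy assms by (simp add: economy_def \<beta>_def)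
  then obtain k where "k > 0" "deriv f k = \<beta> / (1 - \<tau>)"
    by (rule deriv_f_surj)
  with ratio_eqI show "ratio \<tau> > 0" "deriv f (ratio \<tau>) = \<beta> / (1 - \<tau>)"
    by auto
qed

section \<open>Comparative statics in the tax rate\<close>

lemma ratio_decreasing:
  assumes "\<tau> < \<tau>'" "\<tau>' < 1"
  shows "ratio \<tau>' < ratio \<tau>"
proof (rule ccontr)
  assume "\<not> ratio \<tau>' < ratio \<tau>"
  then have "deriv f (ratio \<tau>') \<le> deriv f (ratio \<tau>)"
    using assms monotone_onD[OF deriv_f_decreasing, of "ratio \<tau>" "ratio \<tau>'"] ratio_pos
    by (cases "ratio \<tau> = ratio \<tau>'") (auto simp: less_imp_le)
  moreover have "\<beta> / (1 - \<tau>) < \<beta> / (1 - \<tau>')"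
    using assms economy by (intro divide_strict_left_mono) (auto simp: economy_def \<beta>_def)
  ultimately show False
    using assms deriv_f_ratio by simp
qed

lemma wage_decreasing:
  "strict_antimono_on {0..<1} (\<lambda>\<tau>. f (ratio \<tau>) - ratio \<tau> * deriv f (ratio \<tau>))"
proof (rule monotone_onI)
  fix \<tau> \<tau>' :: real
  assume \<tau>: "\<tau> \<in> {0..<1}" "\<tau>' \<in> {0..<1}" "\<tau> < \<tau>'"
  have "f (ratio \<tau>') - ratio \<tau>' * deriv f (ratio \<tau>') < f (ratio \<tau>) - ratio \<tau> * deriv f (ratio \<tau>)"
  proof (rule DERIV_pos_imp_increasing[where f = "\<lambda>k. f k - k * deriv f k"])
    show "ratio \<tau>' < ratio \<tau>" using \<tau> by (intro ratio_decreasing) auto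
    fix k assume "ratio \<tau>' \<le> k"
    then have k: "k > 0" using ratio_pos[of \<tau>'] \<tau> by simp
    have "((\<lambda>k. f k - k * deriv f k) has_real_derivative - k * deriv (deriv f) k) (at k)"
      using f_has_derivative[OF k] deriv_f_has_derivative[OF k]
      by (auto intro!: derivative_eq_intros)
    moreover have "- k * deriv (deriv f) k > 0"
      using economy k by (simp add: economy_def f_def mult_pos_neg)
    ultimately show "\<exists>y. ((\<lambda>k. f k - k * deriv f k) has_real_derivative y) (at k) \<and> 0 < y"
      by blast
  qed
  then show "f (ratio \<tau>) - ratio \<tau> * deriv f (ratio \<tau>) > f (ratio \<tau>') - ratio \<tau>' * deriv f (ratio \<tau>')"
    by simp
qed

lemma net_output_decreasing:
  "strict_antimono_on {0..<1} (\<lambda>\<tau>. f (ratio \<tau>) - \<beta> * ratio \<tau>)"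
proof (rule monotone_onI)
  fix \<tau> \<tau>' :: real
  assume \<tau>: "\<tau> \<in> {0..<1}" "\<tau>' \<in> {0..<1}" "\<tau> < \<tau>'"
  have pos: "ratio \<tau>' > 0" using \<tau> ratio_pos by simp
  have deriv: "((\<lambda>k. f k - \<beta> * k) has_real_derivative (deriv f k - \<beta>)) (at k)" if "k > 0" for k
    using f_has_derivative[OF that] by (auto intro!: derivative_eq_intros)
  have "f (ratio \<tau>') - \<beta> * ratio \<tau>' < f (ratio \<tau>) - \<beta> * ratio \<tau>"
  \<comment> \<open>The open version matters for \<open>\<tau> = 0\<close>: at the upper end
    \<open>ratio 0\<close> the marginal product equals \<open>\<beta>\<close> and the derivative
    vanishes.\<close>
  proof (rule DERIV_pos_imp_increasing_open[where f = "\<lambda>k. f k - \<beta> * k"])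
    show "ratio \<tau>' < ratio \<tau>" using \<tau> by (intro ratio_decreasing) auto
    show "continuous_on {ratio \<tau>'..ratio \<tau>} (\<lambda>k. f k - \<beta> * k)"
      using pos by (intro continuous_at_imp_continuous_on ballI DERIV_isCont[OF deriv]) auto
    fix k assume k: "ratio \<tau>' < k" "k < ratio \<tau>"
    have "\<beta> \<le> \<beta> / (1 - \<tau>)"
      using \<tau> economy by (simp add: field_simps economy_def \<beta>_def)
    also have "\<dots> < deriv f k"
      using monotone_onD[OF deriv_f_decreasing, of k "ratio \<tau>"] k pos deriv_f_ratio[of \<tau>] \<tau> by simp
    finally show "\<exists>y. ((\<lambda>k. f k - \<beta> * k) has_real_derivative y) (at k) \<and> 0 < y"
      using deriv[of k] k pos by auto
  qed
  then show "f (ratio \<tau>) - \<beta> * ratio \<tau> > f (ratio \<tau>') - \<beta> * ratio \<tau>'"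
    by simp
qed

section \<open>Equilibrium accounting\<close>

lemma prod_fn_eq: "0 \<le> k \<Longrightarrow> 0 < l \<Longrightarrow> prod_fn E k l = l * f (k / l)"
proof -
  assume kl: "0 \<le> k" "0 < l"
  have "prod_fn E (l * (k / l)) (l * 1) = l * prod_fn E (k / l) 1"
    using economy kl unfolding economy_def by (metis divide_nonneg_pos zero_le_one)
  then show ?thesis using kl by (simp add: f_def unit_prod_def)
qed

text \<open>All policies are linear in wealth, so the wealth distribution enters only through its
  mean \<open>m\<close>. Once \<open>m > 0\<close> is known, each market clearing or growth
  condition can be divided by \<open>m\<close> or solved for it.\<close>

lemma steady_state_eqs:
  assumes ss: "steady_state E M \<F> B \<tau> e" and \<tau>: "\<tau> < 1"
  shows "cap_share e = 1"
    and "wage e = f (ratio \<tau>) - ratio \<tau> * deriv f (ratio \<tau>)"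
    and "w > 0 \<Longrightarrow> pol_income E e w = w * deriv f (ratio \<tau>)"
    and "agg_capital e = workers E * ratio \<tau>"
    and "tax_revenue E \<tau> e = \<tau> * deriv f (ratio \<tau>) * (workers E * ratio \<tau>)"
proof -
  let ?D = "wealth_dist e" and ?k = "cap_lab e"
  define m where "m = (LINT w|?D. w)"
  interpret D: prob_space ?D using ss by (simp add: steady_state_def)
  have sets_D: "sets ?D = sets (restrict_space borel {0<..})" and int: "integrable ?D (\<lambda>w. w)" and k: "?k > 0"
    and profit: "\<And>k l. k > 0 \<Longrightarrow> l \<ge> 0 \<Longrightarrow> prod_fn E k l - wage e * l \<le> prod_fn E k (k / ?k) - wage e * (k / ?k)"
    and bonds: "(LINT w|?D. pol_bonds e w) = 0" and labor: "(LINT w|?D. pol_labor e w) = workers E"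
    and growth: "capital_growth E \<tau> e = 0"
    using ss by (auto simp: steady_state_def)
  have space_D: "space ?D = {0<..}"
    using sets_eq_imp_space_eq[OF sets_D] by (simp add: space_restrict_space)
  \<comment> \<open>The wealth distribution is a probability measure on the open half-line, and a
    mean of zero would force wealth to vanish almost surely.\<close>
  have "m > 0"
  proof -
    have "AE w in ?D. 0 \<le> w" by (rule AE_I2) (simp add: space_D)
    then have "m \<ge> 0" unfolding m_def by (rule integral_nonneg_AE)
    moreover have "m \<noteq> 0"
    proof
      assume "m = 0"
      then have "AE w in ?D. w = 0"
        using integral_nonneg_eq_0_iff_AE[OF int \<open>AE w in ?D. 0 \<le> w\<close>] by (simp add: m_def)
      moreover have "AE w in ?D. w \<noteq> 0" by (rule AE_I2) (simp add: space_D)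
      ultimately have "AE w in ?D. False" by eventually_elim simp
      then show False by simp
    qed
    ultimately show ?thesis by simp
  qed
  have "(1 - cap_share e) * m = 0"
    using bonds int by (simp add: pol_bonds_def pol_capital_def m_def left_diff_distrib)
  with \<open>m > 0\<close> show share: "cap_share e = 1" by simp
  have m_eq: "m = workers E * ?k"
    using labor k by (simp add: pol_labor_def pol_capital_def share m_def field_simps)
  have wage: "wage e = f ?k - ?k * deriv f ?k"
  proof -
    \<comment> \<open>first-order condition of a firm with capital \<open>?k\<close>, which optimally employs one worker\<close>
    let ?g = "\<lambda>l. l * f (?k / l) - wage e * l"
    have "(?g has_real_derivative (f ?k - ?k * deriv f ?k - wage e)) (at 1)"
    proof -
      have "((\<lambda>l. f (?k / l)) has_real_derivative deriv f ?k * (- ?k)) (at 1)"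
        by (rule DERIV_chain2[where g = "\<lambda>l. ?k / l"])
          (use f_has_derivative[OF k] in \<open>auto intro!: derivative_eq_intros\<close>)
      then show ?thesis by (auto intro!: derivative_eq_intros)
    qed
    \<comment> \<open>Radius one around \<open>l = 1\<close> keeps labor positive, where homogeneity
      expresses output through \<open>f\<close>.\<close>
    moreover have "\<forall>l. \<bar>1 - l\<bar> < 1 \<longrightarrow> ?g l \<le> ?g 1"
    proof (intro allI impI)
      fix l :: real assume "\<bar>1 - l\<bar> < 1"
      then have "l > 0" by linarith
      then show "?g l \<le> ?g 1"
        using profit[of ?k l] k prod_fn_eq[of ?k l] prod_fn_eq[of ?k 1] by simp
    qed
    ultimately have "f ?k - ?k * deriv f ?k - wage e = 0"
      by (intro DERIV_local_max[of ?g _ 1 1]) auto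
    then show ?thesis by simp
  qed
  \<comment> \<open>Euler's identity: after paying labor its marginal product, constant returns
    leave the marginal product of capital times capital, and bond holdings are zero.\<close>
  have income: "pol_income E e w = w * deriv f ?k" if "w > 0" for w
    using that k prod_fn_eq[of w "w / ?k"]
    by (simp add: pol_income_def income_def pol_capital_def pol_labor_def pol_bonds_def share wage field_simps)
  have "(LINT w|?D. (1 - \<tau>) * pol_income E e w - pol_consumption E w)
      = (LINT w|?D. ((1 - \<tau>) * deriv f ?k - \<beta>) * w)"
    by (rule Bochner_Integration.integral_cong)
      (auto simp: space_D income pol_consumption_def \<beta>_def algebra_simps)
  \<comment> \<open>Exit and entry cancel, because entrants are endowed with the average capital of
    those who leave.\<close>
  then have "capital_growth E \<tau> e = (LINT w|?D. ((1 - \<tau>) * deriv f ?k - \<beta>) * w)"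
    by (simp add: capital_growth_def entrant_capital_def)
  then have "((1 - \<tau>) * deriv f ?k - \<beta>) * m = 0"
    using growth by (simp add: m_def)
  with \<open>m > 0\<close> have "(1 - \<tau>) * deriv f ?k = \<beta>"
    by simp
  then have "deriv f ?k = \<beta> / (1 - \<tau>)"
    using \<tau> by (simp add: field_simps)
  with k have k_eq: "?k = ratio \<tau>"
    using ratio_eqI by simp
  show "wage e = f (ratio \<tau>) - ratio \<tau> * deriv f (ratio \<tau>)"
    using wage by (simp add: k_eq)
  show "w > 0 \<Longrightarrow> pol_income E e w = w * deriv f (ratio \<tau>)"
    using income by (simp add: k_eq)
  show "agg_capital e = workers E * ratio \<tau>"
    using m_eq by (simp add: agg_capital_def pol_capital_def share m_def k_eq)
  have "tax_revenue E \<tau> e = (LINT w|?D. \<tau> * deriv f ?k * w)"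
    unfolding tax_revenue_def
    by (rule Bochner_Integration.integral_cong) (auto simp: space_D income)
  then show "tax_revenue E \<tau> e = \<tau> * deriv f (ratio \<tau>) * (workers E * ratio \<tau>)"
    using m_eq by (simp add: m_def k_eq)
qed

end

subsection \<open>Cobb-Douglas production\<close>

text \<open>Signs are required only strictly between \<open>0\<close> and \<open>1\<close> and away
  from \<open>p\<close>; continuity covers the rest. With \<open>p = 0\<close> the increasing branch
  is the single point \<open>0\<close>.\<close>

lemma single_peaked_at_derivI:
  fixes g :: "real \<Rightarrow> real"
  assumes p: "0 \<le> p" "p < 1" and cont: "continuous_on {0..<1} g"
    and inc: "\<And>x. 0 < x \<Longrightarrow> x < p \<Longrightarrow> \<exists>D. (g has_real_derivative D) (at x) \<and> D > 0"
    and dec: "\<And>x. p < x \<Longrightarrow> x < 1 \<Longrightarrow> \<exists>D. (g has_real_derivative D) (at x) \<and> D < 0"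
  shows "single_peaked_at {0..<1} g p"
  unfolding single_peaked_at_def
proof (intro conjI monotone_onI)
  fix a b assume ab: "a \<in> {0..<1} \<inter> {..p}" "b \<in> {0..<1} \<inter> {..p}" "a < b"
  show "g a < g b"
  proof (rule DERIV_pos_imp_increasing_open[OF \<open>a < b\<close>])
    show "continuous_on {a..b} g" using ab by (intro continuous_on_subset[OF cont]) auto
  qed (use ab inc in auto)
next
  fix a b assume ab: "a \<in> {0..<1} \<inter> {p..}" "b \<in> {0..<1} \<inter> {p..}" "a < b"
  show "g a > g b"
  proof (rule DERIV_neg_imp_decreasing_open[OF \<open>a < b\<close>])
    show "continuous_on {a..b} g" using ab by (intro continuous_on_subset[OF cont]) auto
  qed (use ab dec in auto)
qed (use p in simp)

lemma single_peaked_at_cong: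
  assumes "single_peaked_at S g p" "\<And>x. x \<in> S \<Longrightarrow> h x = g x"
  shows "single_peaked_at S h p"
  using assms by (auto simp: single_peaked_at_def monotone_on_def)

text \<open>The value solves \<open>A * \<rho> * k powr (\<rho> - 1) - \<delta> = disc E / (1 -
  \<tau>)\<close> for \<open>k\<close>.\<close>

lemma the_inv_into_cobb_douglas:
  assumes E: "economy E" and cd: "cobb_douglas E A \<rho> \<delta>" and \<tau>: "\<tau> < 1"
  shows "the_inv_into {0<..} (deriv (unit_prod E)) (disc E / (1 - \<tau>))
    = (A * \<rho> / (disc E / (1 - \<tau>) + \<delta>)) powr (1 / (1 - \<rho>))"
proof (rule ratio_eqI[OF E])
  have A: "A > 0" "0 < \<rho>" "\<rho> < 1" "\<delta> \<ge> 0" using cd by (auto simp: cobb_douglas_def)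
  have \<beta>: "disc E > 0" using E by (simp add: economy_def)
  let ?c = "disc E / (1 - \<tau>) + \<delta>" and ?k = "(A * \<rho> / (disc E / (1 - \<tau>) + \<delta>)) powr (1 / (1 - \<rho>))"
  have c: "?c > 0" using A \<beta> \<tau> by (simp add: add_pos_nonneg)
  show k: "?k > 0" using A c by simp
  have "((\<lambda>k. A * k powr \<rho> - \<delta> * k) has_real_derivative A * (\<rho> * ?k powr (\<rho> - 1)) - \<delta>) (at ?k)"
    using k by (auto intro!: derivative_eq_intros)
  \<comment> \<open>The production formula is assumed only for nonnegative inputs, so the derivative
    is transferred on a neighbourhood of the positive point.\<close>
  moreover have "eventually (\<lambda>k. unit_prod E k = A * k powr \<rho> - \<delta> * k) (nhds ?k)"
    using cd eventually_nhds_in_open[of "{0<..}" ?k] k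
    by (auto elim!: eventually_mono simp: unit_prod_def cobb_douglas_def)
  ultimately have "(unit_prod E has_real_derivative A * (\<rho> * ?k powr (\<rho> - 1)) - \<delta>) (at ?k)"
    by (subst DERIV_cong_ev[OF refl _ refl])
  then have "deriv (unit_prod E) ?k = A * (\<rho> * ?k powr (\<rho> - 1)) - \<delta>"
    by (rule DERIV_imp_deriv)
  also have "?k powr (\<rho> - 1) = (A * \<rho> / ?c) powr (- 1)"
  proof -
    have "1 / (1 - \<rho>) * (\<rho> - 1) = - 1" using A by (simp add: field_simps)
    then show ?thesis by (simp only: powr_powr)
  qed
  also have "\<dots> = ?c / (A * \<rho>)"
    using A c by (simp add: powr_minus)
  also have "A * (\<rho> * (?c / (A * \<rho>))) - \<delta> = disc E / (1 - \<tau>)"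
    using A by simp
  finally show "deriv (unit_prod E) ?k = disc E / (1 - \<tau>)" .
qed

text \<open>The steady state capital-labor ratio at tax rate \<open>x\<close>, with \<open>a\<close>
  standing for \<open>A * \<rho>\<close>.\<close>

definition cobb_douglas_ratio :: "real \<Rightarrow> real \<Rightarrow> real \<Rightarrow> real \<Rightarrow> real \<Rightarrow> real" where
  "cobb_douglas_ratio \<beta> \<delta> \<rho> a x = (a / (\<beta> / (1 - x) + \<delta>)) powr (1 / (1 - \<rho>))"

context
  fixes \<beta> \<delta> \<rho> a :: real
  assumes par: "\<beta> > 0" "\<delta> \<ge> 0" "0 < \<rho>" "\<rho> < 1" "a > 0"
begin

abbreviation (input) cost :: "real \<Rightarrow> real" where
  "cost x \<equiv> \<beta> / (1 - x) + \<delta>"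

abbreviation cd_ratio :: "real \<Rightarrow> real" where
  "cd_ratio \<equiv> cobb_douglas_ratio \<beta> \<delta> \<rho> a"

lemma cost_pos: "x < 1 \<Longrightarrow> cost x > 0"
  using par by (simp add: add_pos_nonneg)

lemma cd_ratio_pos: "x < 1 \<Longrightarrow> cd_ratio x > 0"
  using cost_pos[of x] par by (simp add: cobb_douglas_ratio_def)

text \<open>Written as \<open>cd_ratio x\<close> times a rational function, so that after
  multiplication by another factor the sign of the derivative is decided by a rational
  expression.\<close>

lemma cd_ratio_has_derivative:
  assumes x: "x < 1"
  shows "(cd_ratio has_real_derivative
    - (cd_ratio x * \<beta> / ((1 - \<rho>) * (1 - x) * (\<beta> + \<delta> * (1 - x))))) (at x)"
proof -
  let ?n = "1 / (1 - \<rho>)" and ?q = "\<beta> + \<delta> * (1 - x)"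
  have q: "?q > 0" using par x by (simp add: add_pos_nonneg)
  have cost: "cost x = ?q / (1 - x)" using x by (simp add: field_simps)
  have "((\<lambda>x. a / cost x) has_real_derivative (- (a * (\<beta> / (1 - x)\<^sup>2)) / (cost x)\<^sup>2)) (at x)"
    using x cost_pos[OF x]
    by (auto intro!: derivative_eq_intros simp: power2_eq_square)
  from DERIV_powr[OF this _ DERIV_const, of ?n]
  have "(cd_ratio has_real_derivative cd_ratio x
      * (- (a * (\<beta> / (1 - x)\<^sup>2)) / (cost x)\<^sup>2 * ?n / (a / cost x))) (at x)"
    using cost_pos[OF x] par by (simp add: cobb_douglas_ratio_def[abs_def])
  moreover have "- (a * (\<beta> / (1 - x)\<^sup>2)) / (cost x)\<^sup>2 * ?n / (a / cost x)
      = - (\<beta> / ((1 - \<rho>) * (1 - x) * ?q))"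
    unfolding cost using x q par by (simp add: divide_simps power2_eq_square)
  ultimately show ?thesis by simp
qed

lemma continuous_on_cd_ratio: "continuous_on {0..<1} cd_ratio"
  by (intro continuous_at_imp_continuous_on ballI DERIV_isCont[OF cd_ratio_has_derivative]) auto

lemma single_peaked_revenue:
  "\<exists>p. single_peaked_at {0..<1} (\<lambda>x. x * (\<beta> / (1 - x)) * cd_ratio x) p \<and> p > 0"
proof -
  let ?g = "\<lambda>x. x * (\<beta> / (1 - x)) * cd_ratio x"
  define d where "d = \<beta> + (1 - \<rho>) * \<delta>"
  \<comment> \<open>The numerator of the derivative,
    \<open>(1 - \<rho>) * (\<beta> + \<delta> * (1 - x)) - x * \<beta>\<close>, is affine in
    \<open>x\<close> with slope \<open>- d\<close> and root \<open>p\<close>.\<close>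
  define p where "p = (1 - \<rho>) * (\<beta> + \<delta>) / d"
  have d: "d > 0" using par by (simp add: d_def add_pos_nonneg)
  have p: "p > 0" "p < 1"
    using par d by (simp_all add: p_def add_pos_nonneg) (simp add: d_def algebra_simps)
  have pd: "p * d = (1 - \<rho>) * (\<beta> + \<delta>)" using d by (simp add: p_def)
  have deriv: "\<exists>D. (?g has_real_derivative D * (p - x)) (at x) \<and> D > 0" if x: "0 < x" "x < 1" for x
  proof -
    let ?q = "\<beta> + \<delta> * (1 - x)"
    have q: "?q > 0" using par x by (simp add: add_pos_nonneg)
    have "((\<lambda>x. x * (\<beta> / (1 - x))) has_real_derivative \<beta> / (1 - x)\<^sup>2) (at x)"
      using x by (auto intro!: derivative_eq_intros simp: field_simps power2_eq_square)
    then have "(?g has_real_derivative \<beta> / (1 - x)\<^sup>2 * cd_ratio x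
        + - (cd_ratio x * \<beta> / ((1 - \<rho>) * (1 - x) * ?q)) * (x * (\<beta> / (1 - x)))) (at x)"
      using x by (intro DERIV_mult cd_ratio_has_derivative)
    also have "\<beta> / (1 - x)\<^sup>2 * cd_ratio x + - (cd_ratio x * \<beta> / ((1 - \<rho>) * (1 - x) * ?q)) * (x * (\<beta> / (1 - x)))
        = \<beta> * cd_ratio x / ((1 - \<rho>) * (1 - x)\<^sup>2 * ?q) * ((1 - \<rho>) * ?q - x * \<beta>)"
      using x q par by (simp add: divide_simps power2_eq_square) (simp add: algebra_simps)
    also have "(1 - \<rho>) * ?q - x * \<beta> = d * (p - x)"
      using pd by (simp add: d_def algebra_simps)
    finally have "(?g has_real_derivative
        \<beta> * cd_ratio x / ((1 - \<rho>) * (1 - x)\<^sup>2 * ?q) * d * (p - x)) (at x)"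
      by (simp only: mult.assoc)
    moreover have "\<beta> * cd_ratio x / ((1 - \<rho>) * (1 - x)\<^sup>2 * ?q) * d > 0"
      using x q par d cd_ratio_pos[of x] by simp
    ultimately show ?thesis by blast
  qed
  have "single_peaked_at {0..<1} ?g p"
  proof (rule single_peaked_at_derivI)
    show "continuous_on {0..<1} ?g"
      by (intro continuous_intros continuous_on_cd_ratio) auto
    show "\<exists>D. (?g has_real_derivative D) (at x) \<and> D > 0" if "0 < x" "x < p" for x
      using deriv[of x] that p by (auto intro!: mult_pos_pos)
    show "\<exists>D. (?g has_real_derivative D) (at x) \<and> D < 0" if "p < x" "x < 1" for x
      using deriv[of x] that p by (auto intro!: mult_pos_neg)
  qed (use p in auto)
  with p show ?thesis by blast
qed

text \<open>A higher tax insures against risk but shrinks capital. The logarithmic derivative is the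
  difference of the two effects; over a common denominator its sign is that of
  \<open>H (1 - x) - \<beta>\<^sup>2\<close>, which changes at most once since \<open>H\<close> is
  increasing. The sign at \<open>x = 0\<close> decides whether the peak is interior.\<close>

lemma single_peaked_welfare:
  assumes c: "c > 0"
  shows "\<exists>p. single_peaked_at {0..<1} (\<lambda>x. exp (- (1 / (2 * \<beta>)) * (1 - x)\<^sup>2 * c) * cd_ratio x) p
    \<and> (p > 0 \<longleftrightarrow> \<beta>\<^sup>2 < (1 - \<rho>) * (\<beta> + \<delta>) * c)"
proof -
  let ?e = "\<lambda>x. exp (- (1 / (2 * \<beta>)) * (1 - x)\<^sup>2 * c)"
  let ?g = "\<lambda>x. ?e x * cd_ratio x"
  define H where "H m = (1 - \<rho>) * c * (m\<^sup>2 * (\<beta> + \<delta> * m))" for m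
  have H_mono: "H m < H m'" if "0 \<le> m" "m < m'" for m m'
  proof -
    have "m\<^sup>2 * (\<beta> + \<delta> * m) < m'\<^sup>2 * (\<beta> + \<delta> * m')"
      using that par
      by (intro mult_less_le_imp_less power_strict_mono add_left_mono mult_left_mono add_pos_nonneg) auto
    then show ?thesis using par c by (simp add: H_def)
  qed
  have deriv: "\<exists>D. (?g has_real_derivative D * (H (1 - x) - \<beta>\<^sup>2)) (at x) \<and> D > 0" if x: "0 < x" "x < 1" for x
  proof -
    let ?q = "\<beta> + \<delta> * (1 - x)"
    have q: "?q > 0" using par x by (simp add: add_pos_nonneg)
    have "(?e has_real_derivative ?e x * ((1 - x) * c / \<beta>)) (at x)"
      using par by (auto intro!: derivative_eq_intros) (simp add: divide_simps, simp add: algebra_simps)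
    then have "(?g has_real_derivative ?e x * ((1 - x) * c / \<beta>) * cd_ratio x
        + - (cd_ratio x * \<beta> / ((1 - \<rho>) * (1 - x) * ?q)) * ?e x) (at x)"
      using x by (intro DERIV_mult cd_ratio_has_derivative)
    also have "?e x * ((1 - x) * c / \<beta>) * cd_ratio x + - (cd_ratio x * \<beta> / ((1 - \<rho>) * (1 - x) * ?q)) * ?e x
        = ?e x * cd_ratio x * ((1 - x) * c / \<beta> - \<beta> / ((1 - \<rho>) * (1 - x) * ?q))"
      by (simp add: algebra_simps)
    also have "(1 - x) * c / \<beta> - \<beta> / ((1 - \<rho>) * (1 - x) * ?q)
        = (H (1 - x) - \<beta>\<^sup>2) / (\<beta> * (1 - \<rho>) * (1 - x) * ?q)"
      using x q par by (simp add: H_def divide_simps power2_eq_square)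
    finally have "(?g has_real_derivative
        ?e x * cd_ratio x / (\<beta> * (1 - \<rho>) * (1 - x) * ?q) * (H (1 - x) - \<beta>\<^sup>2)) (at x)"
      by simp
    moreover have "?e x * cd_ratio x / (\<beta> * (1 - \<rho>) * (1 - x) * ?q) > 0"
      using x q par cd_ratio_pos[of x] by simp
    ultimately show ?thesis by blast
  qed
  have H1: "H 1 = (1 - \<rho>) * (\<beta> + \<delta>) * c" by (simp add: H_def)
  obtain p where p: "0 \<le> p" "p < 1" "p > 0 \<longleftrightarrow> \<beta>\<^sup>2 < H 1"
    and below: "\<And>x. 0 < x \<Longrightarrow> x < p \<Longrightarrow> \<beta>\<^sup>2 < H (1 - x)"
    and above: "\<And>x. p < x \<Longrightarrow> x < 1 \<Longrightarrow> H (1 - x) < \<beta>\<^sup>2"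
  proof (cases "\<beta>\<^sup>2 < H 1")
    case True
    have "\<exists>m. 0 \<le> m \<and> m \<le> 1 \<and> H m = \<beta>\<^sup>2"
      \<comment> \<open>\<open>H 0 = 0\<close> lies below \<open>\<beta>\<^sup>2\<close>, and
        \<open>H 1\<close> above it.\<close>
      using True par by (intro IVT) (auto simp: H_def intro!: continuous_intros)
    then obtain m where m: "0 \<le> m" "m \<le> 1" "H m = \<beta>\<^sup>2" by blast
    have "m \<noteq> 0" using m(3) par by (auto simp: H_def)
    moreover have "m \<noteq> 1" using m(3) True by auto
    ultimately show ?thesis
      using m True H_mono[of m] H_mono[of _ m] by (intro that[of "1 - m"]) (auto simp flip: m(3))
  next
    case False
    \<comment> \<open>If \<open>H 1\<close> does not exceed \<open>\<beta>\<^sup>2\<close>, welfare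
      falls from the start and the peak is at zero tax.\<close>
    show ?thesis
    proof (rule that[of 0])
      fix x :: real assume "0 < x" "x < 1"
      then show "H (1 - x) < \<beta>\<^sup>2" using H_mono[of "1 - x" 1] False by simp
    qed (use False in auto)
  qed
  have "single_peaked_at {0..<1} ?g p"
  proof (rule single_peaked_at_derivI)
    show "continuous_on {0..<1} ?g"
      by (intro continuous_intros continuous_on_cd_ratio)
    show "\<exists>D. (?g has_real_derivative D) (at x) \<and> D > 0" if x: "0 < x" "x < p" for x
    proof -
      obtain D where "(?g has_real_derivative D * (H (1 - x) - \<beta>\<^sup>2)) (at x)" "D > 0"
        using deriv[of x] x p by auto
      moreover have "D * (H (1 - x) - \<beta>\<^sup>2) > 0"
        using below[OF x] \<open>D > 0\<close> by simp
      ultimately show ?thesis by blast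
    qed
    show "\<exists>D. (?g has_real_derivative D) (at x) \<and> D < 0" if x: "p < x" "x < 1" for x
    proof -
      obtain D where "(?g has_real_derivative D * (H (1 - x) - \<beta>\<^sup>2)) (at x)" "D > 0"
        using deriv[of x] x p by auto
      moreover have "D * (H (1 - x) - \<beta>\<^sup>2) < 0"
        using above[OF x] \<open>D > 0\<close> by (simp add: mult_pos_neg)
      ultimately show ?thesis by blast
    qed
  qed (use p in auto)
  with p(3) show ?thesis unfolding H1 by blast
qed

end

subsection \<open>The welfare formulas\<close>

text \<open>The policy and the equilibrium equations reduce the budget constraint of an optimal plan
  to the driftless linear equation, so \<open>linear_sde_solution\<close> and
  \<open>value_coefficient\<close> apply with \<open>s = (1 - \<tau>) * vol E\<close>.\<close>

lemma (in brownian) steady_state_val_coef: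
  assumes E: "economy E" and ss: "steady_state E M \<F> B \<tau> e" and \<tau>: "\<tau> < 1"
  shows "val_coef e = disc E * exp (- (rra E * ((1 - \<tau>) * vol E)\<^sup>2 / (2 * disc E)))"
proof -
  let ?r = "the_inv_into {0<..} (deriv (unit_prod E)) (disc E / (1 - \<tau>))"
  let ?s = "(1 - \<tau>) * vol E" and ?J = "\<lambda>w. 1 / (1 - rra E) * (val_coef e * w) powr (1 - rra E)"
  note eqs = steady_state_eqs[OF E ss \<tau>]
  have pos: "disc E > 0" "rra E > 0" "rra E \<noteq> 1" "vol E > 0" "val_coef e > 0"
    using E ss by (auto simp: economy_def steady_state_def)
  have "value_function E \<tau> (interest e) (wage e) M \<F> B (follows_policy E e M) ?J"
    using ss by (simp add: steady_state_def)
  \<comment> \<open>Initial wealth \<open>1\<close> is a convenient choice: \<open>a\<close> is the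
    same for every starting point.\<close>
  then obtain P where pol: "follows_policy E e M P"
    and adm: "admissible E \<tau> (interest e) (wage e) M \<F> B 1 P"
    and ru: "recursive_utility E M \<F> (consumption P) (\<lambda>t x. ?J (wealth P t x))"
    unfolding value_function_def using zero_less_one by blast
  have prog: "progressive \<F> (wealth P)" "progressive \<F> (consumption P)"
    and feasible: "AE x in M. \<forall>t\<ge>0. wealth P t x = capital P t x + bonds P t x \<and> wealth P t x > 0 \<and>
        capital P t x \<ge> 0 \<and> labor P t x \<ge> 0 \<and> consumption P t x > 0"
    and ito': "\<forall>t\<ge>0. has_ito_integral M \<F> B (\<lambda>s x. ?s * capital P s x) t
        (\<lambda>x. wealth P t x - 1 - (LBINT s:{0..t}. wealth_drift E \<tau> (interest e) (wage e) P s x))"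
    using adm unfolding admissible_def by - (elim conjE, assumption)+
  have ito: "has_ito_integral M \<F> B (\<lambda>s x. ?s * capital P s x) t
        (\<lambda>x. wealth P t x - 1 - (LBINT s:{0..t}. wealth_drift E \<tau> (interest e) (wage e) P s x))" if "0 \<le> t" for t
    by (rule ito'[THEN spec, THEN mp, OF that])
  from pol feasible have plan: "AE x in M. \<forall>t\<ge>0. wealth P t x > 0 \<and> capital P t x = wealth P t x
      \<and> consumption P t x = disc E * wealth P t x \<and> wealth_drift E \<tau> (interest e) (wage e) P t x = 0"
    unfolding follows_policy_def
  proof eventually_elim
    case (elim x)
    show ?case
    proof (intro allI impI)
      fix t :: real assume "0 \<le> t"
      with elim have w: "wealth P t x > 0"
        and k: "capital P t x = pol_capital e (wealth P t x)" "labor P t x = pol_labor e (wealth P t x)"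
          "bonds P t x = pol_bonds e (wealth P t x)" "consumption P t x = pol_consumption E (wealth P t x)"
        by blast+
      have "wealth_drift E \<tau> (interest e) (wage e) P t x
          = (1 - \<tau>) * pol_income E e (wealth P t x) - pol_consumption E (wealth P t x)"
        by (simp add: wealth_drift_def pol_income_def k)
      \<comment> \<open>After-tax income is
        \<open>(1 - \<tau>) * deriv f (ratio \<tau>) = \<beta>\<close> per unit of wealth, which is
        the rate of consumption.\<close>
      also have "\<dots> = 0"
        using eqs(3)[OF w] deriv_f_ratio[OF E \<tau>] \<tau> by (simp add: pol_consumption_def)
      finally show "wealth P t x > 0 \<and> capital P t x = wealth P t x
          \<and> consumption P t x = disc E * wealth P t x \<and> wealth_drift E \<tau> (interest e) (wage e) P t x = 0"
        using w k eqs(1) by (simp add: pol_capital_def pol_consumption_def)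
    qed
  qed
  have s: "?s \<noteq> 0" using \<tau> pos by simp
  have W: "AE x in M. wealth P t x = 1 * exp (?s * B t x - ?s\<^sup>2 * t / 2)" if t: "0 \<le> t" for t
  proof (rule linear_sde_solution[OF prog(1) s ito])
    show "AE x in M. ?s * capital P r x = ?s * wealth P r x" if "0 \<le> r" for r
      using plan by eventually_elim (use that in auto)
    show "AE x in M. wealth P r x
        = 1 + (wealth P r x - 1 - (LBINT s:{0..r}. wealth_drift E \<tau> (interest e) (wage e) P s x))" if "0 \<le> r" for r
      using plan
    proof eventually_elim
      case (elim x)
      then have "(LBINT s:{0..r}. wealth_drift E \<tau> (interest e) (wage e) P s x) = (LBINT s:{0..r}. 0)"
        by (intro set_lebesgue_integral_cong) auto
      then show ?case by simp
    qed
  qed (use t in auto)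
  show ?thesis
  proof (rule value_coefficient[where W = "wealth P" and c = "consumption P" and ?w0.0 = 1, OF _ _ _ _ _ s W])
    show "AE x in M. \<forall>t\<ge>0. wealth P t x > 0 \<and> consumption P t x = disc E * wealth P t x"
      using plan by eventually_elim auto
    show "wealth P t \<in> borel_measurable M" "consumption P t \<in> borel_measurable M" if "0 \<le> t" for t
      using measurable_progressive(2)[OF prog(1) that] measurable_progressive(2)[OF prog(2) that]
        measurable_filtration by auto
  qed (use pos ru in auto)
qed

text \<open>The equivalence for the peak of \<open>WE\<close> makes precise when there is an
  increasing phase: the criterion is that welfare rises with the tax near \<open>\<tau> = 0\<close>.
  For the revenue the peak is always interior.\<close>

theorem proposition3:
  fixes E :: economy
    and M :: "'s measure" and \<F> :: "real \<Rightarrow> 's measure" and B :: "real \<Rightarrow> 's \<Rightarrow> real"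
    and f K W0 W1 WE T :: "real \<Rightarrow> real" and \<beta> \<gamma> \<sigma> L :: real
  assumes "economy E" and "brownian_motion M \<F> B"
    and "f = unit_prod E" and "\<beta> = disc E" and "\<gamma> = rra E" and "\<sigma> = vol E" and "L = workers E"
    and "K = (\<lambda>\<tau>. the_inv_into {0<..} (deriv f) (\<beta> / (1 - \<tau>)) * L)"
    and "W0 = (\<lambda>\<tau>. f (K \<tau> / L) - (K \<tau> / L) * deriv f (K \<tau> / L))"
    and "W1 = (\<lambda>\<tau>. f (K \<tau> / L) - \<beta> * K \<tau> / L)"
    and "WE = (\<lambda>\<tau>. \<beta> * exp (- (1 / (2 * \<beta>)) * (1 - \<tau>)\<^sup>2 * \<gamma> * \<sigma>\<^sup>2) * K \<tau>)"
    and "T = (\<lambda>\<tau>. \<tau> * K \<tau> * deriv f (K \<tau> / L))"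
  shows "(\<forall>\<tau>\<in>{0..<1}. \<forall>e. steady_state E M \<F> B \<tau> e \<longrightarrow>
            agg_capital e = K \<tau> \<and>
            worker_welfare_wasted e = W0 \<tau> \<and>
            worker_welfare_redist E \<tau> e = W1 \<tau> \<and>
            entrepreneur_welfare e = WE \<tau> \<and>
            tax_revenue E \<tau> e = T \<tau> \<and>
            T \<tau> = (deriv f (K \<tau> / L) - \<beta>) * K \<tau>)
       \<and> strict_antimono_on {0..<1} W1
       \<and> strict_antimono_on {0..<1} W0
       \<and> (\<forall>A \<rho> \<delta>. cobb_douglas E A \<rho> \<delta> \<longrightarrow>
            (\<exists>p. single_peaked_at {0..<1} WE p \<and> (p > 0 \<longleftrightarrow> \<beta>\<^sup>2 < (1 - \<rho>) * (\<beta> + \<delta>) * \<gamma> * \<sigma>\<^sup>2))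
          \<and> (\<exists>p. single_peaked_at {0..<1} T p \<and> p > 0))"
proof -
  interpret brownian M \<F> B by unfold_locales fact
  define \<kappa> where "\<kappa> \<tau> = the_inv_into {0<..} (deriv f) (\<beta> / (1 - \<tau>))" for \<tau>
  note E = \<open>economy E\<close> and defs = assms(3-7)
  have pos: "\<beta> > 0" "\<gamma> > 0" "\<sigma> > 0" "L > 0"
    using E by (simp_all add: economy_def defs)
  have K: "K \<tau> / L = \<kappa> \<tau>" "K \<tau> = L * \<kappa> \<tau>" for \<tau>
    using pos by (simp_all add: assms(8) \<kappa>_def)
  have \<kappa>: "\<kappa> \<tau> > 0" "deriv f (\<kappa> \<tau>) = \<beta> / (1 - \<tau>)" if "\<tau> < 1" for \<tau>
    using ratio_pos[OF E that] deriv_f_ratio[OF E that] by (simp_all add: \<kappa>_def defs)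
  have steady: "agg_capital e = K \<tau> \<and> worker_welfare_wasted e = W0 \<tau> \<and>
      worker_welfare_redist E \<tau> e = W1 \<tau> \<and> entrepreneur_welfare e = WE \<tau> \<and>
      tax_revenue E \<tau> e = T \<tau> \<and> T \<tau> = (deriv f (K \<tau> / L) - \<beta>) * K \<tau>"
    if \<tau>: "\<tau> \<in> {0..<1}" and ss: "steady_state E M \<F> B \<tau> e" for \<tau> e
  proof -
    have \<tau>1: "\<tau> < 1" using \<tau> by simp
    note eqs = steady_state_eqs[OF E ss \<tau>1, folded defs, folded \<kappa>_def]
    \<comment> \<open>This is \<open>(1 - \<tau>) * deriv f (\<kappa> \<tau>) = \<beta>\<close>
      rearranged; it links the two revenue formulas and turns the wage plus transfers into
      \<open>f - \<beta> * \<kappa>\<close>.\<close>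
    have tax: "\<tau> * deriv f (\<kappa> \<tau>) = deriv f (\<kappa> \<tau>) - \<beta>"
      using \<tau>1 by (simp add: \<kappa> field_simps)
    have agg: "agg_capital e = K \<tau>" using eqs(4) by (simp add: K)
    have W0: "worker_welfare_wasted e = W0 \<tau>"
      using eqs(2) by (simp add: worker_welfare_wasted_def assms(9) K(1))
    have T: "tax_revenue E \<tau> e = T \<tau>"
      using eqs(5) by (simp add: assms(12) K(1)) (simp add: K(2))
    have T': "T \<tau> = (deriv f (K \<tau> / L) - \<beta>) * K \<tau>"
      unfolding assms(12) K(1) tax[symmetric] by simp
    have W1: "worker_welfare_redist E \<tau> e = W1 \<tau>"
    proof -
      have "tax_revenue E \<tau> e / L = (deriv f (\<kappa> \<tau>) - \<beta>) * \<kappa> \<tau>"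
        using pos unfolding T T' K(1) by (simp add: K(2))
      then show ?thesis
        using eqs(2) pos
        by (simp add: worker_welfare_redist_def assms(10) K(1) flip: defs(5) times_divide_eq_right)
          (simp add: algebra_simps)
    qed
    have WE: "entrepreneur_welfare e = WE \<tau>"
      using steady_state_val_coef[OF E ss \<tau>1] agg
      by (simp add: entrepreneur_welfare_def entrant_capital_def assms(11) defs power_mult_distrib ac_simps)
    show ?thesis using agg W0 W1 WE T T' by blast
  qed
  have W1: "W1 = (\<lambda>\<tau>. f (\<kappa> \<tau>) - \<beta> * \<kappa> \<tau>)"
    using K(1) by (simp add: assms(10) flip: times_divide_eq_right)
  have W0: "W0 = (\<lambda>\<tau>. f (\<kappa> \<tau>) - \<kappa> \<tau> * deriv f (\<kappa> \<tau>))"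
    by (simp add: assms(9) K(1))
  have peaks: "(\<exists>p. single_peaked_at {0..<1} WE p \<and> (p > 0 \<longleftrightarrow> \<beta>\<^sup>2 < (1 - \<rho>) * (\<beta> + \<delta>) * \<gamma> * \<sigma>\<^sup>2))
      \<and> (\<exists>p. single_peaked_at {0..<1} T p \<and> p > 0)" if cd: "cobb_douglas E A \<rho> \<delta>" for A \<rho> \<delta>
  proof -
    have par: "0 < \<rho>" "\<rho> < 1" "\<delta> \<ge> 0" "A * \<rho> > 0"
      using cd by (auto simp: cobb_douglas_def)
    have \<kappa>_cd: "\<kappa> \<tau> = cobb_douglas_ratio \<beta> \<delta> \<rho> (A * \<rho>) \<tau>" if "\<tau> < 1" for \<tau>
      using the_inv_into_cobb_douglas[OF E cd that] by (simp add: \<kappa>_def defs cobb_douglas_ratio_def)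
    \<comment> \<open>The peak results are per worker and without constants; the factors
      \<open>\<beta> * L\<close> and \<open>L\<close> are restored here.\<close>
    have scale: "single_peaked_at {0..<1} (\<lambda>x. c * g x) p"
      if "single_peaked_at {0..<1} g p" "c > 0" for c :: real and g p
      using that by (simp add: single_peaked_at_def monotone_on_def)
    obtain p where p: "single_peaked_at {0..<1}
        (\<lambda>x. exp (- (1 / (2 * \<beta>)) * (1 - x)\<^sup>2 * (\<gamma> * \<sigma>\<^sup>2)) * cobb_douglas_ratio \<beta> \<delta> \<rho> (A * \<rho>) x) p"
      "p > 0 \<longleftrightarrow> \<beta>\<^sup>2 < (1 - \<rho>) * (\<beta> + \<delta>) * (\<gamma> * \<sigma>\<^sup>2)"
      using single_peaked_welfare[of \<beta> \<delta> \<rho> "A * \<rho>" "\<gamma> * \<sigma>\<^sup>2"] par pos by auto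
    have "single_peaked_at {0..<1} WE p"
      by (rule single_peaked_at_cong[OF scale[OF p(1), of "\<beta> * L"]])
        (use pos in \<open>auto simp: assms(11) K(2) \<kappa>_cd ac_simps\<close>)
    moreover obtain p' where p': "single_peaked_at {0..<1}
        (\<lambda>x. x * (\<beta> / (1 - x)) * cobb_douglas_ratio \<beta> \<delta> \<rho> (A * \<rho>) x) p'" "p' > 0"
      using single_peaked_revenue[of \<beta> \<delta> \<rho> "A * \<rho>"] par pos by auto
    have "single_peaked_at {0..<1} T p'"
    proof (rule single_peaked_at_cong[OF scale[OF p'(1), of L]])
      fix x :: real assume "x \<in> {0..<1}"
      then have x: "x < 1" by simp
      have "T x = L * (x * (\<beta> / (1 - x)) * \<kappa> x)"
        by (simp add: assms(12) K(1) \<kappa>(2)[OF x]) (simp add: K(2))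
      then show "T x = L * (x * (\<beta> / (1 - x)) * cobb_douglas_ratio \<beta> \<delta> \<rho> (A * \<rho>) x)"
        by (simp only: \<kappa>_cd[OF x])
    qed (use pos in simp)
    ultimately show ?thesis
      using p(2) p'(2) by (auto simp: mult.assoc)
  qed
  show ?thesis
    using steady peaks wage_decreasing[OF E] net_output_decreasing[OF E]
    unfolding W0 W1 by (simp add: \<kappa>_def defs)
qed

end
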